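(* Let $X$ be a path connected metrizable space and $x_0\in X$. Then $\pi_1^{qtop}(X,x_0)$ is a $\mathbf{CG}$-group. Moreover, if the direct product $\pi_1^{qtop}(X,x_0)\times\pi_1^{qtop}(X,x_0)$ (with the product topology) is compactly generated, then $\pi_1^{qtop}(X,x_0)$ is a topological group.
   Context: $\Omega(X,x_0)$ denotes the space of loops $[0,1]\to X$ based at $x_0$ with the compact-open topology. $\pi_1^{qtop}(X,x_0)$ is $\pi_1(X,x_0)$ endowed with the quotient topology with respect to the map $\pi:\Omega(X,x_0)\to\pi_1(X,x_0)$, $\pi(\alpha)=[\alpha]$. A subset $A$ of a topological space $Y$ is k-closed if for each compact Hausdorff space $K$ and continuous map $t:K\to Y$, $t^{-1}(A)$ is closed in $K$. $Y$ is compactly generated if every k-closed subset is closed. For any space $Y$, $\mathbf{k}Y$ is the set $Y$ with the topology whose closed sets are the k-closed sets of $Y$; it is compactly generated. The k-product is $Y\times_k Z=\mathbf{k}(Y\times Z)$. A $\mathbf{CG}$-group is a group $G$ with a compactly generated topology such that inversion $G\to G$ is continuous and multiplication $G\times_k G\to G$ is continuous with respect to the k-product. *)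

theory Defs
  imports "HOL-Analysis.Analysis" "HOL-Algebra.Group"
begin

no_notation eq_closure_of ("closure'_of\<index>")

text \<open>
  A definition cannot quantify over types, so the compact Hausdorff test spaces live on one fixed
  type, chosen large enough: \<open>k_closed_imp_closedin_preimage\<close> below shows that a \<open>k_closed\<close> set has
  closed preimage under every continuous map from a compact Hausdorff space on any type whatsoever.
  No separation axiom is imposed on \<open>Y\<close>, which is why the library's \<open>k_space\<close> (defined through
  compact subsets of \<open>Y\<close>) is not used.
\<close>

definition k_closed :: "'a topology \<Rightarrow> 'a set \<Rightarrow> bool" where
  "k_closed Y A \<longleftrightarrow> A \<subseteq> topspace Y \<and>
     (\<forall>(K :: 'a set set list set topology) t.
        compact_space K \<and> Hausdorff_space K \<and> continuous_map K Y t \<longrightarrow>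
        closedin K {x \<in> topspace K. t x \<in> A})"

definition compactly_generated :: "'a topology \<Rightarrow> bool" where
  "compactly_generated Y \<longleftrightarrow> (\<forall>A. k_closed Y A \<longrightarrow> closedin Y A)"

definition k_ification :: "'a topology \<Rightarrow> 'a topology" where
  "k_ification Y = topology (\<lambda>U. U \<subseteq> topspace Y \<and> k_closed Y (topspace Y - U))"

definition k_prod :: "'a topology \<Rightarrow> 'b topology \<Rightarrow> ('a \<times> 'b) topology" where
  "k_prod Y Z = k_ification (prod_topology Y Z)"

lemma k_closed_topspace: "k_closed Y (topspace Y)"
  unfolding k_closed_def
  by (auto simp: closedin_continuous_map_preimage)

lemma k_closed_empty: "k_closed Y {}"
  unfolding k_closed_def by auto

lemma k_closed_Un:
  assumes "k_closed Y A" "k_closed Y B"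
  shows "k_closed Y (A \<union> B)"
proof -
  have "{x \<in> topspace K. t x \<in> A \<union> B} = {x \<in> topspace K. t x \<in> A} \<union> {x \<in> topspace K. t x \<in> B}"
    for K :: "'a set set list set topology" and t
    by auto
  with assms show ?thesis
    unfolding k_closed_def by (simp add: closedin_Un)
qed

lemma k_closed_Inter:
  assumes "\<F> \<noteq> {}" "\<And>A. A \<in> \<F> \<Longrightarrow> k_closed Y A"
  shows "k_closed Y (\<Inter>\<F>)"
proof -
  have "{x \<in> topspace K. t x \<in> \<Inter>\<F>} = (\<Inter>A\<in>\<F>. {x \<in> topspace K. t x \<in> A})"
    for K :: "'a set set list set topology" and t
    using assms(1) by auto
  moreover have "\<Inter>\<F> \<subseteq> topspace Y"
    using assms by (auto simp: k_closed_def)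
  ultimately show ?thesis
    using assms unfolding k_closed_def by (metis (mono_tags, lifting) closedin_INT)
qed

lemma openin_k_ification:
  "openin (k_ification Y) U \<longleftrightarrow> U \<subseteq> topspace Y \<and> k_closed Y (topspace Y - U)"
proof -
  have "istopology (\<lambda>U. U \<subseteq> topspace Y \<and> k_closed Y (topspace Y - U))"
    unfolding istopology_def
  proof (intro conjI allI impI)
    fix S T
    assume "S \<subseteq> topspace Y \<and> k_closed Y (topspace Y - S)"
      and "T \<subseteq> topspace Y \<and> k_closed Y (topspace Y - T)"
    then show "S \<inter> T \<subseteq> topspace Y" "k_closed Y (topspace Y - S \<inter> T)"
      by (auto simp: Diff_Int k_closed_Un)
  next
    fix \<K>
    assume *: "\<forall>U\<in>\<K>. U \<subseteq> topspace Y \<and> k_closed Y (topspace Y - U)"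
    then show "\<Union>\<K> \<subseteq> topspace Y" by auto
    show "k_closed Y (topspace Y - \<Union>\<K>)"
    proof (cases "\<K> = {}")
      case False
      then have "topspace Y - \<Union>\<K> = \<Inter>((\<lambda>U. topspace Y - U) ` \<K>)" by auto
      moreover have "k_closed Y (\<Inter>((\<lambda>U. topspace Y - U) ` \<K>))"
        using False * by (intro k_closed_Inter) auto
      ultimately show ?thesis by simp
    qed (simp add: k_closed_topspace)
  qed
  then show ?thesis
    by (simp add: k_ification_def topology_inverse')
qed

lemma topspace_k_ification [simp]: "topspace (k_ification Y) = topspace Y"
proof -
  have "openin (k_ification Y) (topspace Y)"
    by (simp add: openin_k_ification k_closed_empty)
  then show ?thesis
    by (meson openin_k_ification openin_subset openin_topspace subset_antisym)
qed

lemma closedin_k_ification: "closedin (k_ification Y) A \<longleftrightarrow> k_closed Y A"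
proof -
  have "A \<subseteq> topspace Y \<Longrightarrow> topspace Y - (topspace Y - A) = A" by auto
  moreover have "A \<subseteq> topspace Y" if "k_closed Y A"
    using that by (simp add: k_closed_def)
  ultimately show ?thesis
    by (auto simp: closedin_def openin_k_ification)
qed

lemma inj_homeomorphic_copy:
  assumes "inj_on h (topspace X)"
  obtains X' where "homeomorphic_map X X' h"
proof -
  define X' where "X' = topology (\<lambda>V. V \<subseteq> h ` topspace X \<and> openin X {x \<in> topspace X. h x \<in> V})"
  have "istopology (\<lambda>V. V \<subseteq> h ` topspace X \<and> openin X {x \<in> topspace X. h x \<in> V})"
    unfolding istopology_def
  proof (intro conjI allI impI)
    fix S T
    assume "S \<subseteq> h ` topspace X \<and> openin X {x \<in> topspace X. h x \<in> S}"
      and "T \<subseteq> h ` topspace X \<and> openin X {x \<in> topspace X. h x \<in> T}"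
    moreover have "{x \<in> topspace X. h x \<in> S \<inter> T}
        = {x \<in> topspace X. h x \<in> S} \<inter> {x \<in> topspace X. h x \<in> T}" by auto
    ultimately show "S \<inter> T \<subseteq> h ` topspace X" "openin X {x \<in> topspace X. h x \<in> S \<inter> T}"
      by auto
  next
    fix \<K>
    assume *: "\<forall>U\<in>\<K>. U \<subseteq> h ` topspace X \<and> openin X {x \<in> topspace X. h x \<in> U}"
    have "{x \<in> topspace X. h x \<in> \<Union>\<K>} = (\<Union>U\<in>\<K>. {x \<in> topspace X. h x \<in> U})" by auto
    with * show "\<Union>\<K> \<subseteq> h ` topspace X" "openin X {x \<in> topspace X. h x \<in> \<Union>\<K>}"
      by auto
  qed
  then have op: "openin X' V \<longleftrightarrow> V \<subseteq> h ` topspace X \<and> openin X {x \<in> topspace X. h x \<in> V}" for V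
    by (simp add: X'_def topology_inverse')
  have "{x \<in> topspace X. h x \<in> h ` topspace X} = topspace X" by auto
  then have "openin X' (h ` topspace X)" by (simp add: op)
  then have top: "topspace X' = h ` topspace X"
    by (meson op openin_subset openin_topspace subset_antisym)
  have "quotient_map X X' h"
    by (auto simp: quotient_map_def top op)
  with assms have "homeomorphic_map X X' h"
    by (simp add: homeomorphic_map_def)
  then show thesis by (rule that)
qed

lemma k_closed_test:
  fixes Y :: "'a topology" and K :: "'b topology" and h :: "'b \<Rightarrow> 'a set set list set"
  assumes A: "k_closed Y A" and h: "inj h"
    and K: "compact_space K" "Hausdorff_space K" and t: "continuous_map K Y t"
  shows "closedin K {x \<in> topspace K. t x \<in> A}"
proof -
  obtain K' where hom: "homeomorphic_map K K' h"
    using inj_homeomorphic_copy h by (metis inj_on_subset subset_UNIV)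
  then obtain g where g: "homeomorphic_maps K K' h g"
    using homeomorphic_map_maps by blast
  then have hs: "K homeomorphic_space K'"
    by (auto simp: homeomorphic_space_def)
  have "compact_space K'" "Hausdorff_space K'"
    using K hs homeomorphic_compact_space homeomorphic_Hausdorff_space by blast+
  moreover have "continuous_map K' Y (t \<circ> g)"
    using g t by (auto simp: homeomorphic_maps_def intro: continuous_map_compose)
  ultimately have "closedin K' {x \<in> topspace K'. (t \<circ> g) x \<in> A}"
    using A[unfolded k_closed_def, THEN conjunct2, rule_format, of K' "t \<circ> g"] by blast
  then have "closedin K {x \<in> topspace K. h x \<in> {x \<in> topspace K'. (t \<circ> g) x \<in> A}}"
    using g by (intro closedin_continuous_map_preimage[of K K' h]) (simp_all add: homeomorphic_maps_def)
  moreover have "{x \<in> topspace K. h x \<in> {x \<in> topspace K'. (t \<circ> g) x \<in> A}} = {x \<in> topspace K. t x \<in> A}"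
    using g by (auto simp: homeomorphic_maps_def continuous_map_def)
  ultimately show ?thesis by simp
qed

lemma compact_space_Inter_nonempty:
  assumes "compact_space X" "\<And>C. C \<in> \<U> \<Longrightarrow> closedin X C"
    and "\<And>\<F>. finite \<F> \<Longrightarrow> \<F> \<subseteq> \<U> \<Longrightarrow> \<Inter>\<F> \<noteq> {}"
  shows "\<Inter>\<U> \<noteq> {}"
proof -
  have "(\<forall>C\<in>\<U>. closedin X C) \<and> (\<forall>\<F>. finite \<F> \<and> \<F> \<subseteq> \<U> \<longrightarrow> \<Inter>\<F> \<noteq> {})"
    using assms(2,3) by simp
  then show ?thesis
    by (rule compact_space_fip[THEN iffD1, OF assms(1), THEN spec, THEN mp])
qed

abbreviation cantor :: "('i \<Rightarrow> bool) topology" where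
  "cantor \<equiv> product_topology (\<lambda>_. discrete_topology UNIV) UNIV"

lemma openin_cantor: "openin cantor {p. p i}" "openin cantor {p. \<not> p i}"
proof -
  have "openin cantor {p \<in> topspace cantor. p i \<in> V}" for V :: "bool set"
    by (rule openin_continuous_map_preimage[OF continuous_map_product_projection]) auto
  from this[of "{True}"] this[of "{False}"]
  show "openin cantor {p. p i}" "openin cantor {p. \<not> p i}" by auto
qed

lemma closedin_cantor: "closedin cantor {p. p i}" "closedin cantor {p. \<not> p i}"
  using openin_cantor[of i] by (auto simp: closedin_def Collect_neg_eq[symmetric] Compl_eq_Diff_UNIV[symmetric])

lemma closedin_cantor_Int: "closedin cantor {p. p i = (p j \<and> p k)}"
proof -
  have "{p. p i = (p j \<and> p k)} =
      ({p. p i} \<inter> ({p. p j} \<inter> {p. p k})) \<union> ({p. \<not> p i} \<inter> ({p. \<not> p j} \<union> {p. \<not> p k}))" by auto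
  then show ?thesis
    by (simp add: closedin_cantor closedin_Int closedin_Un)
qed

lemma closedin_cantor_Compl: "closedin cantor {p. p i = (\<not> p j)}"
proof -
  have "{p. p i = (\<not> p j)} = ({p. p i} \<inter> {p. \<not> p j}) \<union> ({p. \<not> p i} \<inter> {p. p j})" by auto
  then show ?thesis
    by (simp add: closedin_cantor closedin_Int closedin_Un)
qed

lemma compact_cantor: "compact_space cantor"
  by (simp add: compact_space_product_topology compact_space_discrete_topology)

lemma Hausdorff_cantor: "Hausdorff_space cantor"
  by (simp add: Hausdorff_space_product_topology Hausdorff_space_discrete_topology)

lemma ultrafilter_at:
  assumes v: "v \<in> X closure_of S"
  obtains u :: "'k set \<Rightarrow> bool" where
    "\<And>b c. u (b \<inter> c) \<longleftrightarrow> u b \<and> u c"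
    "\<And>b. u (- b) \<longleftrightarrow> \<not> u b"
    "\<And>b. u b \<Longrightarrow> b \<inter> S \<noteq> {}"
    "\<And>N. openin X N \<Longrightarrow> v \<in> N \<Longrightarrow> u N"
proof -
  define \<Phi> :: "'k \<Rightarrow> 'k set \<Rightarrow> bool" where "\<Phi> x b \<longleftrightarrow> x \<in> b" for x b
  define C where "C N = cantor closure_of (\<Phi> ` (S \<inter> N))" for N
  have ne: "S \<inter> N \<noteq> {}" if "openin X N" "v \<in> N" for N
    using v that by (auto simp: in_closure_of)
  have vX: "v \<in> topspace X" using v by (simp add: in_closure_of)
  let ?N = "{N. openin X N \<and> v \<in> N}"
  have "\<Inter>(C ` ?N) \<noteq> {}"
  proof (rule compact_space_Inter_nonempty[OF compact_cantor])
    show "closedin cantor D" if "D \<in> C ` ?N" for D using that by (auto simp: C_def)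
    show "\<Inter>\<F> \<noteq> {}" if fin: "finite \<F>" and sub: "\<F> \<subseteq> C ` ?N" for \<F>
    proof -
      obtain \<N> where \<N>: "finite \<N>" "\<N> \<subseteq> ?N" "\<F> = C ` \<N>"
        using fin sub by (meson finite_subset_image)
      define M where "M = \<Inter>(insert (topspace X) \<N>)"
      have "openin X M" unfolding M_def using \<N> by (intro openin_Inter) auto
      moreover have "v \<in> M" using \<N> vX by (auto simp: M_def)
      ultimately obtain x where x: "x \<in> S \<inter> M" using ne by blast
      have "\<Phi> x \<in> C N" if "N \<in> \<N>" for N
      proof -
        have "\<Phi> x \<in> \<Phi> ` (S \<inter> N)" using x that by (auto simp: M_def)
        moreover have "\<Phi> ` (S \<inter> N) \<subseteq> C N"
          unfolding C_def by (rule closure_of_subset) simp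
        ultimately show ?thesis by blast
      qed
      then show ?thesis using \<N> by blast
    qed
  qed
  then obtain u where u: "\<And>N. openin X N \<Longrightarrow> v \<in> N \<Longrightarrow> u \<in> C N" by auto
  have clo: "u \<in> D" if "closedin cantor D" "openin X N" "v \<in> N" "\<And>x. x \<in> S \<inter> N \<Longrightarrow> \<Phi> x \<in> D" for D N
  proof -
    have "C N \<subseteq> D" unfolding C_def using that by (intro closure_of_minimal) auto
    with u that show ?thesis by blast
  qed
  have clo': "u \<in> D" if "closedin cantor D" "\<And>x. x \<in> S \<Longrightarrow> \<Phi> x \<in> D" for D
    using clo[of D "topspace X"] that vX by auto
  show thesis
  proof (rule that)
    show "u (b \<inter> c) \<longleftrightarrow> u b \<and> u c" for b c
      using clo'[OF closedin_cantor_Int[of "b \<inter> c" b c]] by (auto simp: \<Phi>_def)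
    show "u (- b) \<longleftrightarrow> \<not> u b" for b
      using clo'[OF closedin_cantor_Compl[of "- b" b]] by (auto simp: \<Phi>_def)
    show "b \<inter> S \<noteq> {}" if "u b" for b
      using clo'[OF closedin_cantor(2)[of b]] that by (auto simp: \<Phi>_def)
    show "u N" if "openin X N" "v \<in> N" for N
      using clo[OF closedin_cantor(1)[of N] that] by (auto simp: \<Phi>_def)
  qed
qed

text \<open>
  Given a compact Hausdorff space \<open>K\<close> on an arbitrary type and a map \<open>t : K \<rightarrow> Y\<close>, the terms below
  index a small Boolean algebra of subsets of \<open>K\<close> whose Stone space replaces \<open>K\<close>.
\<close>

datatype 'a ix =
    Whole
  | Meet "'a ix" "'a ix"
  | Neg "'a ix"
  | Pick "'a ix" "'a set set" "'a set"
  | Nbhd "'a set"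
  | Sing "'a ix"

primrec code :: "'a ix \<Rightarrow> 'a set set list" where
  "code Whole = [{}, {}, {}]"
| "code (Meet i j) = [{}, {}, UNIV] @ code i @ code j"
| "code (Neg i) = [{}, UNIV, {}] @ code i"
| "code (Pick i F U) = [{}, UNIV, UNIV] @ code i @ [F, {U}]"
| "code (Nbhd U) = [UNIV, {}, {}, {U}]"
| "code (Sing i) = [UNIV, {}, UNIV] @ code i"

lemma code_prefix: "code i @ r = code j @ s \<Longrightarrow> i = j \<and> r = s"
proof (induction i arbitrary: j r s)
  case (Meet i1 i2)
  show ?case
  proof (cases j)
    case j: (Meet j1 j2)
    with Meet.prems have "code i1 @ (code i2 @ r) = code j1 @ (code j2 @ s)" by simp
    from Meet.IH(1)[OF this] have "i1 = j1" "code i2 @ r = code j2 @ s" by auto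
    with Meet.IH(2) j show ?thesis by blast
  qed (use Meet.prems in auto)
next
  case (Pick i F U)
  show ?case
  proof (cases j)
    case j: (Pick i' F' U')
    with Pick.prems have "code i @ (F # {U} # r) = code i' @ (F' # {U'} # s)" by simp
    from Pick.IH[OF this] j show ?thesis by auto
  qed (use Pick.prems in auto)
next
  case Whole
  then show ?case by (cases j) auto
next
  case (Neg i)
  then show ?case by (cases j) auto
next
  case (Nbhd U)
  then show ?case by (cases j) auto
next
  case (Sing i)
  then show ?case by (cases j) auto
qed

lemma inj_code: "inj (\<lambda>p. code ` {i. p i})"
proof (rule injI)
  fix p q :: "'a ix \<Rightarrow> bool"
  assume "code ` {i. p i} = code ` {i. q i}"
  moreover have "inj (code :: 'a ix \<Rightarrow> _)"
    using code_prefix[of _ "[]" _ "[]"] by (auto intro: injI)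
  ultimately have "{i. p i} = {i. q i}" by (simp add: inj_image_eq_iff)
  then show "p = q" by auto
qed

primrec alg :: "'k set \<Rightarrow> ('k set \<Rightarrow> 'a set set \<Rightarrow> 'a set \<Rightarrow> 'k set) \<Rightarrow> ('a set \<Rightarrow> 'k set) \<Rightarrow>
    ('k set \<Rightarrow> 'k) \<Rightarrow> 'a ix \<Rightarrow> 'k set" where
  "alg T c n e Whole = T"
| "alg T c n e (Meet i j) = alg T c n e i \<inter> alg T c n e j"
| "alg T c n e (Neg i) = T - alg T c n e i"
| "alg T c n e (Pick i F U) = T \<inter> c (alg T c n e i) F U"
| "alg T c n e (Nbhd U) = T \<inter> n U"
| "alg T c n e (Sing i) = T \<inter> {e (alg T c n e i)}"

lemma alg_subset: "alg T c n e i \<subseteq> T"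
  by (induction i) auto

lemma finite_refinement:
  assumes K: "compact_space K" "Hausdorff_space K"
    and b: "b \<subseteq> topspace K" and F: "\<And>U. U \<in> F \<Longrightarrow> openin K (P U)"
    and cov: "K closure_of b \<subseteq> (\<Union>U\<in>F. P U)"
  shows "\<exists>c F'. finite F' \<and> F' \<subseteq> F \<and> (\<forall>U. K closure_of (c U) \<subseteq> P U) \<and> b \<subseteq> (\<Union>U\<in>F'. c U)"
proof -
  have reg: "regular_space K"
    using K by (simp add: compact_Hausdorff_imp_regular_space)
  have "\<exists>N U. openin K N \<and> x \<in> N \<and> U \<in> F \<and> K closure_of N \<subseteq> P U"
    if x: "x \<in> K closure_of b" for x
  proof -
    obtain U where U: "U \<in> F" "x \<in> P U" using cov x by blast
    then have "openin K (P U)" using F by blast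
    then obtain N V where "openin K N" "closedin K V" "x \<in> N" "N \<subseteq> V" "V \<subseteq> P U"
      using reg U(2) unfolding neighbourhood_base_of_closedin[symmetric] neighbourhood_base_of
      by meson
    then show ?thesis using U(1) by (meson closure_of_minimal subset_trans)
  qed
  then obtain N V where NV: "\<And>x. x \<in> K closure_of b \<Longrightarrow>
      openin K (N x) \<and> x \<in> N x \<and> V x \<in> F \<and> K closure_of (N x) \<subseteq> P (V x)"
    by metis
  have "compactin K (K closure_of b)"
    using K by (simp add: closedin_compact_space)
  moreover have "\<forall>U\<in>N ` (K closure_of b). openin K U" "K closure_of b \<subseteq> \<Union>(N ` (K closure_of b))"
    using NV by blast+
  ultimately obtain \<F> where \<F>: "finite \<F>" "\<F> \<subseteq> N ` (K closure_of b)" "K closure_of b \<subseteq> \<Union>\<F>"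
    unfolding compactin_def by meson
  then obtain X where X: "finite X" "X \<subseteq> K closure_of b" "\<F> = N ` X"
    by (meson finite_subset_image)
  define c where "c U = (\<Union>x\<in>{x \<in> X. V x = U}. N x)" for U
  have "K closure_of (c U) \<subseteq> P U" for U
  proof -
    have "K closure_of (c U) = (\<Union>x\<in>{x \<in> X. V x = U}. K closure_of (N x))"
      using X(1) by (simp add: c_def closure_of_Union)
    also have "\<dots> \<subseteq> P U" using NV X(2) by blast
    finally show ?thesis .
  qed
  moreover have "b \<subseteq> (\<Union>U\<in>V ` X. c U)"
  proof -
    have "b \<subseteq> K closure_of b" using b by (simp add: closure_of_subset)
    also have "\<dots> \<subseteq> (\<Union>U\<in>V ` X. c U)" using \<F>(3) unfolding X(3) c_def by blast
    finally show ?thesis .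
  qed
  moreover have "V ` X \<subseteq> F" using NV X(2) by blast
  ultimately show ?thesis using X(1) by blast
qed

theorem k_closed_imp_closedin_preimage:
  fixes Y :: "'a topology" and K :: "'k topology"
  assumes A: "k_closed Y A"
    and K: "compact_space K" "Hausdorff_space K" and t: "continuous_map K Y t"
  shows "closedin K {x \<in> topspace K. t x \<in> A}"
proof (rule ccontr)
  assume ncl: "\<not> ?thesis"
  define T where "T = topspace K"
  define S where "S = {x \<in> T. t x \<in> A}"
  define P where "P U = {x \<in> T. t x \<in> U}" for U
  have oP: "openin K (P U)" if "openin Y U" for U
    using t that by (simp add: P_def T_def openin_continuous_map_preimage)
  have "\<not> ((K closure_of S) \<subseteq> S)"
    using ncl closure_of_subset_eq[of S K] by (auto simp: S_def T_def)
  then obtain v where v: "v \<in> K closure_of S" "v \<notin> S" by blast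
  have vT: "v \<in> T" using v(1) by (simp add: in_closure_of T_def)
  have tvA: "t v \<notin> A" using v(2) vT by (simp add: S_def)
  obtain u :: "'k set \<Rightarrow> bool" where
    u_Int: "\<And>b c. u (b \<inter> c) \<longleftrightarrow> u b \<and> u c" and
    u_Compl: "\<And>b. u (- b) \<longleftrightarrow> \<not> u b" and
    u_S: "\<And>b. u b \<Longrightarrow> b \<inter> S \<noteq> {}" and
    u_N: "\<And>N. openin K N \<Longrightarrow> v \<in> N \<Longrightarrow> u N"
    using ultrafilter_at[OF v(1)] by blast
  have uT: "u T" using u_N vT by (simp add: T_def)
  have "\<exists>e. e \<in> b \<inter> S" if "u b" for b using u_S[OF that] by blast
  then obtain e where e: "\<And>b. u b \<Longrightarrow> e b \<in> b \<inter> S" by metis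
  have "\<exists>c F'. (finite F' \<and> F' \<subseteq> F \<and> (\<forall>U. K closure_of (c U) \<subseteq> P U) \<and> b \<subseteq> (\<Union>U\<in>F'. c U))"
    if "b \<subseteq> T \<and> (\<forall>U\<in>F. openin Y U) \<and> K closure_of b \<subseteq> (\<Union>U\<in>F. P U)" for b F
    using finite_refinement[OF K, of b F P] oP that by (simp add: T_def)
  then obtain c where c: "\<And>b F. b \<subseteq> T \<and> (\<forall>U\<in>F. openin Y U) \<and> K closure_of b \<subseteq> (\<Union>U\<in>F. P U) \<Longrightarrow>
      \<exists>F'. finite F' \<and> F' \<subseteq> F \<and> (\<forall>U. K closure_of (c b F U) \<subseteq> P U) \<and> b \<subseteq> (\<Union>U\<in>F'. c b F U)"
    by metis
  have "\<exists>N. openin K N \<and> v \<in> N \<and> K closure_of N \<subseteq> P U" if "openin Y U \<and> t v \<in> U" for U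
  proof -
    have "openin K (P U)" "v \<in> P U" using that oP vT by (auto simp: P_def)
    moreover have "regular_space K" using K by (simp add: compact_Hausdorff_imp_regular_space)
    ultimately obtain N V where "openin K N" "closedin K V" "v \<in> N" "N \<subseteq> V" "V \<subseteq> P U"
      unfolding neighbourhood_base_of_closedin[symmetric] neighbourhood_base_of by meson
    then show ?thesis by (meson closure_of_minimal subset_trans)
  qed
  then obtain n where n: "\<And>U. openin Y U \<and> t v \<in> U \<Longrightarrow>
      openin K (n U) \<and> v \<in> n U \<and> K closure_of (n U) \<subseteq> P U"
    by metis
  define B where "B = alg T c n e"
  have BT: "B i \<subseteq> T" for i by (simp add: B_def alg_subset)
  have B_simps: "B Whole = T" "B (Meet i j) = B i \<inter> B j" "B (Neg i) = T - B i"
      "B (Pick i F U) = T \<inter> c (B i) F U" "B (Nbhd U) = T \<inter> n U" "B (Sing i) = T \<inter> {e (B i)}"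
    for i j F U by (simp_all add: B_def)
  define K1 where "K1 = {p :: 'a ix \<Rightarrow> bool. p Whole \<and> (\<forall>i j. p (Meet i j) = (p i \<and> p j)) \<and>
      (\<forall>i. p (Neg i) = (\<not> p i)) \<and> (\<forall>i. B i = {} \<longrightarrow> \<not> p i)}"
  have cK1: "closedin cantor K1"
  proof -
    have eq: "K1 = {p. p Whole} \<inter> (\<Inter>(i,j)\<in>UNIV. {p. p (Meet i j) = (p i \<and> p j)}) \<inter>
       (\<Inter>i\<in>UNIV. {p. p (Neg i) = (\<not> p i)}) \<inter> (\<Inter>i\<in>insert (Neg Whole) {i. B i = {}}. {p. \<not> p i})"
      by (auto simp: K1_def B_simps)
    have c1: "closedin cantor (\<Inter>(i,j)\<in>UNIV. {p. p (Meet i j) = (p i \<and> p j)})"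
      by (rule closedin_INT) (auto intro: closedin_cantor_Int)
    have c2: "closedin cantor (\<Inter>i\<in>UNIV. {p. p (Neg i) = (\<not> p i)})"
      by (rule closedin_INT) (auto intro: closedin_cantor_Compl)
    have c3: "closedin cantor (\<Inter>i\<in>insert (Neg Whole) {i. B i = {}}. {p. \<not> p i})"
      by (rule closedin_INT) (auto intro: closedin_cantor)
    show ?thesis
      unfolding eq by (rule closedin_Int[OF closedin_Int[OF closedin_Int[OF closedin_cantor(1) c1] c2] c3])
  qed
  define L where "L = subtopology (cantor :: ('a ix \<Rightarrow> bool) topology) K1"
  have topL: "topspace L = K1" by (simp add: L_def)
  have cL: "compact_space L"
    unfolding L_def by (intro compact_space_subtopology closedin_compact_space[OF compact_cantor cK1])
  have HL: "Hausdorff_space L"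
    by (simp add: L_def Hausdorff_cantor Hausdorff_space_subtopology)
  define Q where "Q p x \<longleftrightarrow> x \<in> T \<and> (\<forall>i. p i \<longrightarrow> x \<in> K closure_of (B i)) \<and>
      (\<forall>U. openin Y U \<and> t x \<in> U \<longrightarrow> (\<exists>i. p i \<and> K closure_of (B i) \<subseteq> P U))" for p :: "'a ix \<Rightarrow> bool" and x

  have diff: "\<exists>j. p j \<and> B j = B i - (\<Union>U\<in>F'. B (Pick i F U))"
    if p: "p \<in> K1" and "p i" "finite F'" "\<And>U. U \<in> F' \<Longrightarrow> \<not> p (Pick i F U)" for p i F F'
    using that(3,4)
  proof (induction F' rule: finite_induct)
    case empty
    then show ?case using \<open>p i\<close> by auto
  next
    case (insert U F')
    then obtain j where j: "p j" "B j = B i - (\<Union>U\<in>F'. B (Pick i F U))" by auto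
    have "p (Meet j (Neg (Pick i F U)))"
      using p j(1) insert.prems by (auto simp: K1_def)
    moreover have "B (Meet j (Neg (Pick i F U))) = B i - (\<Union>U\<in>insert U F'. B (Pick i F U))"
      unfolding B_simps(2,3) j(2) using BT[of i] by auto
    ultimately show ?case by blast
  qed

  have exQ: "\<exists>x. Q p x" if p: "p \<in> K1" for p
  proof -
    define F where "F = {U. openin Y U \<and> \<not> (\<exists>i. p i \<and> K closure_of (B i) \<subseteq> P U)}"
    have FD: "\<not> p i" if "U \<in> F" "K closure_of (B i) \<subseteq> P U" for U i
      using that unfolding F_def by blast
    define W where "W = (\<Union>U\<in>F. P U)"
    have oW: "openin K W" unfolding W_def using oP by (intro openin_Union) (auto simp: F_def)
    have ne: "\<not> K closure_of (B i) \<subseteq> W" if "p i" for i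
    proof
      assume "K closure_of (B i) \<subseteq> W"
      then have "B i \<subseteq> T \<and> (\<forall>U\<in>F. openin Y U) \<and> K closure_of (B i) \<subseteq> (\<Union>U\<in>F. P U)"
        using BT by (auto simp: F_def W_def)
      from c[OF this] obtain F' where F': "finite F'" "F' \<subseteq> F"
          "\<forall>U. K closure_of (c (B i) F U) \<subseteq> P U" "B i \<subseteq> (\<Union>U\<in>F'. c (B i) F U)"
        by blast
      have "K closure_of (B (Pick i F U)) \<subseteq> P U" for U
        unfolding B_simps using F'(3) closure_of_mono[of "T \<inter> c (B i) F U" "c (B i) F U" K] by blast
      then have "\<not> p (Pick i F U)" if "U \<in> F'" for U
        using that F'(2) FD by blast
      then obtain j where j: "p j" "B j = B i - (\<Union>U\<in>F'. B (Pick i F U))"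
        using diff[OF p \<open>p i\<close> F'(1)] by blast
      have "B j = {}" unfolding j(2) B_simps using F'(4) BT[of i] by blast
      with j(1) p show False by (auto simp: K1_def)
    qed
    define D where "D i = K closure_of (B i) - W" for i
    have D_closed: "closedin K (D i)" for i
      unfolding D_def using oW by (intro closedin_diff) auto
    have Dmeet: "\<exists>j. p j \<and> (\<forall>i\<in>I. D j \<subseteq> D i)" if "finite I" "\<And>i. i \<in> I \<Longrightarrow> p i" for I
      using that
    proof (induction I rule: finite_induct)
      case empty
      then show ?case using p by (auto simp: K1_def)
    next
      case (insert i I)
      then obtain j where j: "p j" "\<forall>i\<in>I. D j \<subseteq> D i" by auto
      have "p (Meet i j)" using p j insert.prems by (auto simp: K1_def)
      moreover have "D (Meet i j) \<subseteq> D i" "D (Meet i j) \<subseteq> D j"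
        unfolding D_def B_simps
        using closure_of_mono[of "B i \<inter> B j" "B i" K] closure_of_mono[of "B i \<inter> B j" "B j" K] by auto
      ultimately show ?case using j(2) by blast
    qed
    have "\<Inter>(D ` {i. p i}) \<noteq> {}"
    proof (rule compact_space_Inter_nonempty[OF K(1)])
      show "closedin K E" if "E \<in> D ` {i. p i}" for E using that D_closed by auto
      show "\<Inter>\<F> \<noteq> {}" if fin: "finite \<F>" and sub: "\<F> \<subseteq> D ` {i. p i}" for \<F>
      proof -
        obtain I where I: "finite I" "I \<subseteq> {i. p i}" "\<F> = D ` I"
          using fin sub by (meson finite_subset_image)
        then obtain j where "p j" "\<forall>i\<in>I. D j \<subseteq> D i" using Dmeet[of I] by blast
        moreover have "D j \<noteq> {}" using ne[OF \<open>p j\<close>] by (auto simp: D_def)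
        ultimately show ?thesis using I(3) by blast
      qed
    qed
    then obtain x where x: "\<And>i. p i \<Longrightarrow> x \<in> D i" by blast
    have "p Whole" using p by (simp add: K1_def)
    then have "x \<in> D Whole" by (rule x)
    then have xT: "x \<in> T" "x \<notin> W" by (auto simp: D_def T_def in_closure_of)
    have "Q p x" unfolding Q_def
    proof (intro conjI allI impI)
      fix U assume U: "openin Y U \<and> t x \<in> U"
      show "\<exists>i. p i \<and> K closure_of (B i) \<subseteq> P U"
      proof (rule ccontr)
        assume "\<not> ?thesis"
        then have "U \<in> F" using U by (auto simp: F_def)
        then have "x \<in> W" using U xT(1) by (auto simp: W_def P_def)
        with xT(2) show False by blast
      qed
    qed (use xT x in \<open>auto simp: D_def\<close>)
    then show ?thesis by blast
  qed

  define pv where "pv i \<longleftrightarrow> u (B i)" for i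
  define \<phi> where "\<phi> x i \<longleftrightarrow> x \<in> B i" for x i
  have u_empty: "\<not> u {}" using u_S by blast
  have pvK1: "pv \<in> K1"
  proof -
    have "u (T - b) = (\<not> u b)" for b
      using u_Int[of T "- b"] u_Compl[of b] uT by (simp add: Diff_eq)
    then show ?thesis
      using u_Int uT u_empty by (auto simp: K1_def pv_def B_simps)
  qed
  have \<phi>K1: "\<phi> x \<in> K1" if "x \<in> T" for x
    using that by (auto simp: K1_def \<phi>_def B_simps)
  have Qv: "Q pv v" unfolding Q_def
  proof (intro conjI allI impI)
    fix i assume "pv i"
    then have ui: "u (B i)" by (simp add: pv_def)
    have "\<exists>y. y \<in> B i \<and> y \<in> N" if "v \<in> N" "openin K N" for N
    proof -
      have "u (B i \<inter> N)" using ui u_N that u_Int by blast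
      then show ?thesis using u_S by blast
    qed
    then show "v \<in> K closure_of (B i)" using vT by (auto simp: in_closure_of T_def)
  next
    fix U assume U: "openin Y U \<and> t v \<in> U"
    have "u (T \<inter> n U)" using u_Int uT u_N n[OF U] by blast
    then have "pv (Nbhd U)" by (simp add: pv_def B_simps)
    moreover have "K closure_of (B (Nbhd U)) \<subseteq> P U"
      unfolding B_simps using n[OF U] closure_of_mono[of "T \<inter> n U" "n U" K] by blast
    ultimately show "\<exists>i. pv i \<and> K closure_of (B i) \<subseteq> P U" by blast
  qed (rule vT)

  define E where "E = {e (B i) | i. u (B i)}"
  have ES: "x \<in> S" if "x \<in> E" for x using that e by (auto simp: E_def)
  have ET: "x \<in> T" if "x \<in> E" for x using ES[OF that] by (simp add: S_def)
  have closed_sing: "closedin K {x}" if "x \<in> T" for x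
    using K(2) that by (simp add: T_def closedin_Hausdorff_sing_eq)
  have QE: "Q (\<phi> x) x" if x: "x \<in> E" for x unfolding Q_def
  proof (intro conjI allI impI)
    fix i assume "\<phi> x i"
    then show "x \<in> K closure_of (B i)"
      using closure_of_subset[of "B i" K] BT[of i] by (auto simp: \<phi>_def T_def)
  next
    fix U assume U: "openin Y U \<and> t x \<in> U"
    obtain i where i: "x = e (B i)" using x by (auto simp: E_def)
    have "B (Sing i) = {x}" using ET[OF x] i by (auto simp: B_simps)
    then have "\<phi> x (Sing i) \<and> K closure_of (B (Sing i)) \<subseteq> P U"
      using closed_sing[OF ET[OF x]] U ET[OF x] by (simp add: \<phi>_def closure_of_closedin P_def)
    then show "\<exists>i. \<phi> x i \<and> K closure_of (B i) \<subseteq> P U" by blast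
  qed (rule ET[OF x])
  have \<phi>_ne: "\<phi> x \<noteq> pv" if x: "x \<in> E" for x
  proof
    assume eq: "\<phi> x = pv"
    obtain i where i: "x = e (B i)" using x by (auto simp: E_def)
    have Bs: "B (Sing i) = {x}" using ET[OF x] i by (auto simp: B_simps)
    then have "pv (Sing i)" using eq by (auto simp: \<phi>_def fun_eq_iff)
    then have "u {x}" using Bs by (simp add: pv_def)
    moreover have "v \<noteq> x" using v(2) ES[OF x] by blast
    then have "u (T - {x})"
      using closed_sing[OF ET[OF x]] vT by (intro u_N) (auto simp: T_def closedin_def)
    ultimately have "u ({x} \<inter> (T - {x}))" using u_Int by blast
    then show False using u_empty by auto
  qed

  define g where "g p = (if p = pv then v else if \<exists>x\<in>E. p = \<phi> x then SOME x. x \<in> E \<and> p = \<phi> x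
      else SOME x. Q p x)" for p
  have g_E: "g p \<in> E \<and> p = \<phi> (g p)" if "p = \<phi> x" "x \<in> E" for p x
  proof -
    have "\<exists>x. x \<in> E \<and> p = \<phi> x" using that by blast
    from someI_ex[OF this] show ?thesis using \<phi>_ne that by (auto simp: g_def)
  qed
  have Qg: "Q p (g p)" if "p \<in> K1" for p
  proof -
    consider "p = pv" | "p \<noteq> pv" "\<exists>x\<in>E. p = \<phi> x" | "p \<noteq> pv" "\<not> (\<exists>x\<in>E. p = \<phi> x)" by blast
    then show ?thesis
    proof cases
      case 1 then show ?thesis using Qv by (simp add: g_def)
    next
      case 2 then show ?thesis using g_E QE by metis
    next
      case 3
      then have "g p = (SOME x. Q p x)" unfolding g_def by simp
      then show ?thesis using someI_ex[OF exQ[OF that]] by simp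
    qed
  qed
  have cont: "continuous_map L Y (t \<circ> g)"
    unfolding continuous_map_def
  proof (intro conjI allI impI)
    show "t \<circ> g \<in> topspace L \<rightarrow> topspace Y"
      using Qg t by (auto simp: topL Q_def T_def continuous_map_def)
  next
    fix U assume U: "openin Y U"
    show "openin L {p \<in> topspace L. (t \<circ> g) p \<in> U}"
    proof (subst openin_subopen, intro ballI)
      fix p assume "p \<in> {p \<in> topspace L. (t \<circ> g) p \<in> U}"
      then have p: "p \<in> K1" "t (g p) \<in> U" by (auto simp: topL)
      then obtain i where i: "p i" "K closure_of (B i) \<subseteq> P U"
        using Qg[OF p(1)] U by (auto simp: Q_def)
      have "openin L (K1 \<inter> {p. p i})"
        unfolding L_def by (rule openin_subtopology_Int2[OF openin_cantor(1)])
      moreover have "p \<in> K1 \<inter> {p. p i}" using p i by auto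
      moreover have "K1 \<inter> {p. p i} \<subseteq> {p \<in> topspace L. (t \<circ> g) p \<in> U}"
      proof
        fix q assume q: "q \<in> K1 \<inter> {p. p i}"
        then have "g q \<in> K closure_of (B i)" using Qg by (auto simp: Q_def)
        then show "q \<in> {p \<in> topspace L. (t \<circ> g) p \<in> U}"
          using i(2) q by (auto simp: P_def topL)
      qed
      ultimately show "\<exists>V. openin L V \<and> p \<in> V \<and> V \<subseteq> {p \<in> topspace L. (t \<circ> g) p \<in> U}" by blast
    qed
  qed
  have cl: "closedin L {p \<in> topspace L. (t \<circ> g) p \<in> A}" (is "closedin L ?Z")
    by (rule k_closed_test[OF A inj_code cL HL cont])
  have pv_notin: "pv \<in> topspace L - ?Z"
    using pvK1 tvA by (simp add: topL g_def)
  have "openin L (topspace L - ?Z)" using cl by blast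
  then obtain O' where O': "openin cantor O'" "topspace L - ?Z = O' \<inter> K1"
    by (auto simp: L_def openin_subtopology)
  then have "pv \<in> O'" using pv_notin by blast
  then obtain X where X: "finite {i. X i \<noteq> (UNIV :: bool set)}" "pv \<in> Pi\<^sub>E UNIV X" "Pi\<^sub>E UNIV X \<subseteq> O'"
    using O'(1) unfolding openin_product_topology_alt by fastforce
  have "\<exists>j. pv j \<and> (\<forall>p\<in>K1. p j \<longrightarrow> (\<forall>i\<in>I. p i = pv i))" if "finite I" for I
    using that
  proof (induction I rule: finite_induct)
    case empty
    then show ?case using pvK1 by (auto simp: K1_def)
  next
    case (insert i I)
    then obtain j where j: "pv j" "\<forall>p\<in>K1. p j \<longrightarrow> (\<forall>i\<in>I. p i = pv i)" by auto
    define i' where "i' = (if pv i then i else Neg i)"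
    have i': "p i' \<longleftrightarrow> p i = pv i" if "p \<in> K1" for p
      using that by (auto simp: i'_def K1_def)
    have meet: "p (Meet i' j) \<longleftrightarrow> p i' \<and> p j" if "p \<in> K1" for p
      using that by (auto simp: K1_def)
    have "pv (Meet i' j)"
      using meet[OF pvK1] i'[OF pvK1] j(1) by blast
    moreover have "\<forall>k\<in>insert i I. p k = pv k" if "p \<in> K1" "p (Meet i' j)" for p
    proof -
      have "p i = pv i" "p j" using that meet i' by blast+
      then show ?thesis using that(1) j(2) by blast
    qed
    ultimately show ?case by blast
  qed
  from this[OF X(1)] obtain j where j: "pv j" "\<forall>p\<in>K1. p j \<longrightarrow> (\<forall>i\<in>{i. X i \<noteq> UNIV}. p i = pv i)"
    by (elim exE conjE)
  define x where "x = e (B j)"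
  have uj: "u (B j)" using j(1) by (simp add: pv_def)
  have xE: "x \<in> E" using uj by (auto simp: E_def x_def)
  have xK1: "\<phi> x \<in> K1" using \<phi>K1 ET xE by blast
  have "\<phi> x j" using e[OF uj] by (simp add: \<phi>_def x_def)
  then have agree: "\<phi> x i = pv i" if "X i \<noteq> UNIV" for i using bspec[OF j(2) xK1] that by simp
  have "\<phi> x i \<in> X i" for i
    using agree[of i] X(2) by (cases "X i = UNIV") (auto simp: PiE_iff)
  then have "\<phi> x \<in> Pi\<^sub>E UNIV X" by (simp add: PiE_iff)
  then have "\<phi> x \<in> topspace L - ?Z" using X(3) O'(2) xK1 by blast
  then have "t (g (\<phi> x)) \<notin> A" using xK1 by (simp add: topL)
  moreover have "g (\<phi> x) \<in> S" using g_E[OF refl xE] ES by blast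
  ultimately show False by (simp add: S_def)
qed

definition topological_group :: "('a, 'b) monoid_scheme \<Rightarrow> 'a topology \<Rightarrow> bool" where
  "topological_group G T \<longleftrightarrow> group G \<and> topspace T = carrier G \<and>
     continuous_map T T (\<lambda>x. inv\<^bsub>G\<^esub> x) \<and>
     continuous_map (prod_topology T T) T (\<lambda>(x, y). x \<otimes>\<^bsub>G\<^esub> y)"

definition CG_group :: "('a, 'b) monoid_scheme \<Rightarrow> 'a topology \<Rightarrow> bool" where
  "CG_group G T \<longleftrightarrow> group G \<and> topspace T = carrier G \<and> compactly_generated T \<and>
     continuous_map T T (\<lambda>x. inv\<^bsub>G\<^esub> x) \<and>
     continuous_map (k_prod T T) T (\<lambda>(x, y). x \<otimes>\<^bsub>G\<^esub> y)"

text \<open>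
  Points of a mapping space are total functions, so they are made unique by requiring the value
  \<open>undefined\<close> off the domain.
\<close>

definition compact_open :: "'a topology \<Rightarrow> 'b topology \<Rightarrow> ('a \<Rightarrow> 'b) topology" where
  "compact_open Z X =
     subtopology
       (topology_generated_by {{f. f ` C \<subseteq> U} | C U. compactin Z C \<and> openin X U})
       {f \<in> extensional (topspace Z). continuous_map Z X f}"

definition loops :: "'a topology \<Rightarrow> 'a \<Rightarrow> (real \<Rightarrow> 'a) set" where
  "loops X x0 = {\<alpha> \<in> extensional {0..1}. pathin X \<alpha> \<and> \<alpha> 0 = x0 \<and> \<alpha> 1 = x0}"

definition loop_space :: "'a topology \<Rightarrow> 'a \<Rightarrow> (real \<Rightarrow> 'a) topology" where
  "loop_space X x0 = subtopology (compact_open (top_of_set {0..1}) X) (loops X x0)"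

lemma topspace_loop_space [simp]: "topspace (loop_space X x0) = loops X x0"
proof -
  have "\<exists>C U. {f :: real \<Rightarrow> 'a. True} = {f. f ` C \<subseteq> U} \<and> compactin (top_of_set {0..1}) C \<and> openin X U"
    by (intro exI[of _ "{}"]) auto
  then have "\<Union>{{f :: real \<Rightarrow> 'a. f ` C \<subseteq> U} | C U. compactin (top_of_set {0..1}) C \<and> openin X U} = UNIV"
    by blast
  then show ?thesis
    by (auto simp: loop_space_def compact_open_def loops_def pathin_def)
qed

definition loop_class :: "'a topology \<Rightarrow> 'a \<Rightarrow> (real \<Rightarrow> 'a) \<Rightarrow> (real \<Rightarrow> 'a) set" where
  "loop_class X x0 \<alpha> =
     {\<beta> \<in> loops X x0. homotopic_with (\<lambda>\<gamma>. \<gamma> 0 = x0 \<and> \<gamma> 1 = x0) (top_of_set {0..1}) X \<alpha> \<beta>}"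

definition loop_concat :: "(real \<Rightarrow> 'a) \<Rightarrow> (real \<Rightarrow> 'a) \<Rightarrow> (real \<Rightarrow> 'a)" where
  "loop_concat \<alpha> \<beta> = (\<lambda>s\<in>{0..1}. if s \<le> 1/2 then \<alpha> (2 * s) else \<beta> (2 * s - 1))"

text \<open>
  The product below is the usual \<open>[\<alpha>][\<beta>] = [\<alpha> \<cdot> \<beta>]\<close>: the union ranges over all representatives,
  which all yield the same class.
\<close>

definition fundamental_group :: "'a topology \<Rightarrow> 'a \<Rightarrow> (real \<Rightarrow> 'a) set monoid" where
  "fundamental_group X x0 =
     \<lparr>carrier = loop_class X x0 ` loops X x0,
      mult = (\<lambda>a b. \<Union>\<alpha>\<in>a. \<Union>\<beta>\<in>b. loop_class X x0 (loop_concat \<alpha> \<beta>)),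
      one = loop_class X x0 (\<lambda>s\<in>{0..1}. x0)\<rparr>"

definition pi1_qtop :: "'a topology \<Rightarrow> 'a \<Rightarrow> (real \<Rightarrow> 'a) set topology" where
  "pi1_qtop X x0 = topology (\<lambda>U. U \<subseteq> loop_class X x0 ` loops X x0 \<and>
     openin (loop_space X x0) {\<alpha> \<in> loops X x0. loop_class X x0 \<alpha> \<in> U})"

lemma openin_pi1_qtop:
  "openin (pi1_qtop X x0) U \<longleftrightarrow> U \<subseteq> loop_class X x0 ` loops X x0 \<and>
     openin (loop_space X x0) {\<alpha> \<in> loops X x0. loop_class X x0 \<alpha> \<in> U}"
proof -
  let ?P = "\<lambda>U. {\<alpha> \<in> loops X x0. loop_class X x0 \<alpha> \<in> U}"
  have "?P (S \<inter> T) = ?P S \<inter> ?P T" for S T by auto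
  moreover have "?P (\<Union>\<K>) = \<Union>(?P ` \<K>)" for \<K> by auto
  ultimately have "istopology (\<lambda>U. U \<subseteq> loop_class X x0 ` loops X x0 \<and> openin (loop_space X x0) (?P U))"
    unfolding istopology_def by (auto intro!: openin_Union simp del: Union_iff)
  then show ?thesis
    by (simp add: pi1_qtop_def topology_inverse')
qed

lemma topspace_pi1_qtop [simp]: "topspace (pi1_qtop X x0) = loop_class X x0 ` loops X x0"
proof -
  have "{\<alpha> \<in> loops X x0. loop_class X x0 \<alpha> \<in> loop_class X x0 ` loops X x0} = loops X x0" by auto
  then have "openin (pi1_qtop X x0) (loop_class X x0 ` loops X x0)"
    using openin_topspace[of "loop_space X x0"] by (simp add: openin_pi1_qtop)
  then show ?thesis
    by (meson openin_pi1_qtop openin_subset openin_topspace subset_antisym)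
qed

lemma quotient_map_loop_class: "quotient_map (loop_space X x0) (pi1_qtop X x0) (loop_class X x0)"
  by (auto simp: quotient_map_def openin_pi1_qtop)

end

theory Submission
  imports Defs
begin

text \<open>
  For metrizable \<open>X\<close> the loop space is metrizable (the compact-open topology is the topology of
  uniform convergence), hence a Hausdorff \<open>k_space\<close>, and so its quotient \<open>pi1_qtop\<close> is compactly
  generated. Concatenation of loops is continuous, so everything reduces to showing that a subset of
  the product of two quotients is \<open>k_closed\<close> as soon as its preimage upstairs is closed. This is tested
  on a compact Hausdorff space: one factor at a time is replaced by a compact space, and Whitehead's
  theorem (the product of a quotient map with a locally compact space is again a quotient map) applies.
\<close>

section \<open>The compact-open topology and its subbasis\<close>

lemma topspace_compact_open:
  "topspace (compact_open Z X) = {f \<in> extensional (topspace Z). continuous_map Z X f}"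
proof -
  \<comment> \<open>The subbasic set for \<open>C = {}\<close> and \<open>U = {}\<close> contains
    every function, so the subbasis covers the whole type and only the subtopology cuts the space
    down.\<close>
  have "f \<in> \<Union>{{f. f ` C \<subseteq> U} | C U. compactin Z C \<and> openin X U}" for f :: "'a \<Rightarrow> 'b"
    by (rule UnionI[of "{f. f ` {} \<subseteq> {}}"]) blast+
  then show ?thesis
    by (auto simp: compact_open_def)
qed

lemma openin_compact_open_subbasic:
  assumes "compactin Z C" "openin X U"
  shows "openin (compact_open Z X) {f \<in> topspace (compact_open Z X). f ` C \<subseteq> U}"
proof -
  have "openin (topology_generated_by {{f. f ` C \<subseteq> U} | C U. compactin Z C \<and> openin X U}) {f. f ` C \<subseteq> U}"
    by (rule topology_generated_by_Basis) (use assms in blast)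
  then have "openin (compact_open Z X)
      ({f. f ` C \<subseteq> U} \<inter> {f \<in> extensional (topspace Z). continuous_map Z X f})"
    unfolding compact_open_def by (rule openin_subtopology_Int)
  moreover have "{f. f ` C \<subseteq> U} \<inter> {f \<in> extensional (topspace Z). continuous_map Z X f}
      = {f \<in> topspace (compact_open Z X). f ` C \<subseteq> U}"
    by (auto simp: topspace_compact_open)
  ultimately show ?thesis by simp
qed

lemma continuous_map_into_compact_open:
  assumes F: "\<And>t. t \<in> topspace T \<Longrightarrow> F t \<in> topspace (compact_open Z X)"
    and op: "\<And>C U. compactin Z C \<Longrightarrow> openin X U \<Longrightarrow> openin T {t \<in> topspace T. F t ` C \<subseteq> U}"
  shows "continuous_map T (compact_open Z X) F"
  unfolding compact_open_def
proof (rule continuous_map_into_subtopology)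
  show "continuous_map T (topology_generated_by {{f. f ` C \<subseteq> U} | C U. compactin Z C \<and> openin X U}) F"
    unfolding continuous_on_generated_topo_iff
  proof (intro conjI allI impI)
    fix V assume "V \<in> {{f. f ` C \<subseteq> U} | C U. compactin Z C \<and> openin X U}"
    then obtain C U where V: "V = {f. f ` C \<subseteq> U}" and "compactin Z C" "openin X U" by blast
    have "F -` V \<inter> topspace T = {t \<in> topspace T. F t ` C \<subseteq> U}" by (auto simp: V)
    with op[OF \<open>compactin Z C\<close> \<open>openin X U\<close>] show "openin T (F -` V \<inter> topspace T)" by simp
  next
    have "f \<in> \<Union>{{f. f ` C \<subseteq> U} | C U. compactin Z C \<and> openin X U}" for f :: "'b \<Rightarrow> 'c"
      by (rule UnionI[of "{f. f ` {} \<subseteq> {}}"]) blast+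
    then show "F ` topspace T \<subseteq> \<Union>{{f. f ` C \<subseteq> U} | C U. compactin Z C \<and> openin X U}" by blast
  qed
  show "F \<in> topspace T \<rightarrow> {f \<in> extensional (topspace Z). continuous_map Z X f}"
    using F by (auto simp: topspace_compact_open)
qed

section \<open>The supremum metric, and metrizability of loop spaces\<close>

locale sup_metric = Metric_space M d for M :: "'b set" and d +
  fixes Z :: "'a topology"
begin

abbreviation maps where "maps \<equiv> topspace (compact_open Z mtopology)"

text \<open>
  The cap at \<open>1\<close> keeps the supremum bounded, and the extra \<open>0\<close> keeps it nonempty when \<open>Z\<close> is empty.
\<close>

definition sup_dist where
  "sup_dist f g = (SUP r\<in>insert 0 ((\<lambda>z. min 1 (d (f z) (g z))) ` topspace Z). r)"

lemma min_dist_triangle: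
  assumes "x \<in> M" "y \<in> M" "z \<in> M"
  shows "min 1 (d x z) \<le> min 1 (d x y) + min 1 (d y z)"
  using triangle[OF assms] nonneg[of x y] nonneg[of y z] by linarith

lemma sup_dist_upper: "z \<in> topspace Z \<Longrightarrow> min 1 (d (f z) (g z)) \<le> sup_dist f g"
  unfolding sup_dist_def
  by (rule cSUP_upper) (auto simp: bdd_above_def intro!: exI[of _ 1])

lemma sup_dist_nonneg: "0 \<le> sup_dist f g"
  unfolding sup_dist_def
  by (rule cSUP_upper) (auto simp: bdd_above_def intro!: exI[of _ 1])

lemma sup_dist_least:
  assumes "0 \<le> r" "\<And>z. z \<in> topspace Z \<Longrightarrow> min 1 (d (f z) (g z)) \<le> r"
  shows "sup_dist f g \<le> r"
  unfolding sup_dist_def by (rule cSUP_least) (use assms in auto)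

lemma maps_in: "f \<in> maps \<Longrightarrow> z \<in> topspace Z \<Longrightarrow> f z \<in> M"
  by (auto simp: topspace_compact_open continuous_map_def)

text \<open>Maps in \<open>maps\<close> agree off \<open>topspace Z\<close> by extensionality, so
  vanishing of the supremum forces equality of functions. The triangle inequality passes from the
  capped pointwise distances to their supremum.\<close>

sublocale sup: Metric_space maps sup_dist
proof
  show "0 \<le> sup_dist f g" for f g by (rule sup_dist_nonneg)
  show "sup_dist f g = sup_dist g f" for f g by (simp add: sup_dist_def commute)
  show "sup_dist f g = 0 \<longleftrightarrow> f = g" if f: "f \<in> maps" and g: "g \<in> maps" for f g
  proof
    assume 0: "sup_dist f g = 0"
    have "f z = g z" if z: "z \<in> topspace Z" for z
      using sup_dist_upper[OF z, of f g] 0 nonneg[of "f z" "g z"]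
        zero[OF maps_in[OF f z] maps_in[OF g z]] by linarith
    then show "f = g"
      using f g by (intro extensionalityI[of f "topspace Z"]) (auto simp: topspace_compact_open)
  next
    assume "f = g"
    then have "sup_dist f g \<le> 0"
      using maps_in[OF f] by (intro sup_dist_least) auto
    with sup_dist_nonneg[of f g] show "sup_dist f g = 0" by linarith
  qed
  show "sup_dist f h \<le> sup_dist f g + sup_dist g h"
    if "f \<in> maps" "g \<in> maps" "h \<in> maps" for f g h
  proof (rule sup_dist_least)
    show "0 \<le> sup_dist f g + sup_dist g h" using sup_dist_nonneg by (simp add: add_nonneg_nonneg)
    fix z assume z: "z \<in> topspace Z"
    show "min 1 (d (f z) (h z)) \<le> sup_dist f g + sup_dist g h"
      using min_dist_triangle[OF that(1,2,3)[THEN maps_in[OF _ z]]]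
        sup_dist_upper[OF z, of f g] sup_dist_upper[OF z, of g h] by linarith
  qed
qed

lemma openin_sup_mtopology:
  assumes C: "compactin Z C" and U: "openin mtopology U"
  shows "openin sup.mtopology {f \<in> maps. f ` C \<subseteq> U}"
  unfolding sup.openin_mtopology
proof (intro conjI strip)
  fix f assume "f \<in> {f \<in> maps. f ` C \<subseteq> U}"
  then have f: "f \<in> maps" "f ` C \<subseteq> U" by auto
  then have "compactin mtopology (f ` C)"
    using C by (auto simp: topspace_compact_open intro: image_compactin)
  then obtain r where r: "r > 0" "\<And>z. z \<in> C \<Longrightarrow> mball (f z) r \<subseteq> U"
    using lebesgue_number[of "f ` C" "{U}"] f(2) U by auto
  have "g ` C \<subseteq> U" if g: "g \<in> sup.mball f (min 1 r)" for g
  proof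
    fix y assume "y \<in> g ` C"
    then obtain z where z: "z \<in> C" "y = g z" by blast
    then have zZ: "z \<in> topspace Z" using compactin_subset_topspace[OF C] by blast
    have "sup_dist f g < min 1 r" "g \<in> maps" using g by auto
    \<comment> \<open>Below the radius \<open>min 1 r\<close> the cap at \<open>1\<close> is
      inactive, so the capped distance is the true one.\<close>
    then have "d (f z) (g z) < r" using sup_dist_upper[OF zZ, of f g] by linarith
    then have "g z \<in> mball (f z) r"
      using maps_in[OF f(1) zZ] maps_in[OF \<open>g \<in> maps\<close> zZ] by auto
    then show "y \<in> U" using r(2)[OF z(1)] z(2) by blast
  qed
  then show "\<exists>r>0. sup.mball f r \<subseteq> {f \<in> maps. f ` C \<subseteq> U}"
    using r(1) sup.mball_subset_mspace by (intro exI[of _ "min 1 r"] conjI) (simp, blast)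
qed blast

text \<open>By regularity every point has an open \<open>V z\<close> inside a compact
  \<open>C z\<close> that \<open>f\<close> sends into a small ball, and finitely many
  \<open>V z\<close> cover \<open>Z\<close>. A map \<open>g\<close> sending these finitely many
  \<open>C z\<close> into the same balls is uniformly close to \<open>f\<close>, which is a basic
  compact-open condition.\<close>

lemma compact_open_nbhd:
  assumes Z: "compact_space Z" "regular_space Z" and f: "f \<in> maps" and r: "r > 0"
  obtains N where "openin (compact_open Z mtopology) N" "f \<in> N" "N \<subseteq> sup.mball f r"
proof -
  have cf: "continuous_map Z mtopology f" using f by (simp add: topspace_compact_open)
  \<comment> \<open>Two points of a ball of radius \<open>e\<close> are less than
    \<open>2 * e\<close> apart, but the supremum only inherits \<open>\<le> 2 * e\<close>; a third
    of \<open>r\<close> leaves room for the strict inequality.\<close>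
  define e where "e = r / 3"
  have e: "e > 0" using r by (simp add: e_def)
  have "\<exists>V C. openin Z V \<and> compactin Z C \<and> z \<in> V \<and> V \<subseteq> C \<and> f ` C \<subseteq> mball (f z) e"
    if z: "z \<in> topspace Z" for z
  proof -
    have "openin Z {w \<in> topspace Z. f w \<in> mball (f z) e}"
      using cf by (rule openin_continuous_map_preimage) auto
    moreover have "z \<in> {w \<in> topspace Z. f w \<in> mball (f z) e}"
      using z maps_in[OF f z] e by simp
    ultimately obtain V C where "openin Z V" "closedin Z C" "z \<in> V" "V \<subseteq> C"
        "C \<subseteq> {w \<in> topspace Z. f w \<in> mball (f z) e}"
      using Z(2) unfolding neighbourhood_base_of_closedin[symmetric] neighbourhood_base_of by meson
    then show ?thesis using closedin_compact_space[OF Z(1)] by blast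
  qed
  then obtain V C where VC: "\<And>z. z \<in> topspace Z \<Longrightarrow> openin Z (V z) \<and> compactin Z (C z) \<and>
      z \<in> V z \<and> V z \<subseteq> C z \<and> f ` C z \<subseteq> mball (f z) e"
    by metis
  have "\<forall>W\<in>V ` topspace Z. openin Z W" "topspace Z \<subseteq> \<Union>(V ` topspace Z)"
    using VC by blast+
  then obtain \<F> where \<F>: "finite \<F>" "\<F> \<subseteq> V ` topspace Z" "topspace Z \<subseteq> \<Union>\<F>"
    using Z(1) unfolding compact_space_alt by meson
  then obtain S where S: "finite S" "S \<subseteq> topspace Z" "\<F> = V ` S"
    by (meson finite_subset_image)
  have cov: "topspace Z \<subseteq> \<Union>(V ` S)" using \<F>(3) S(3) by simp
  \<comment> \<open>The factor \<open>maps\<close> matters when \<open>S\<close> is empty, where the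
    intersection over \<open>S\<close> would be the whole type.\<close>
  define N where "N = maps \<inter> (\<Inter>z\<in>S. {g \<in> maps. g ` C z \<subseteq> mball (f z) e})"
  show thesis
  proof (rule that)
    have "openin (compact_open Z mtopology) (\<Inter>(insert maps ((\<lambda>z. {g \<in> maps. g ` C z \<subseteq> mball (f z) e}) ` S)))"
      using S VC by (intro openin_Inter) (auto intro!: openin_compact_open_subbasic)
    then show "openin (compact_open Z mtopology) N" by (simp add: N_def)
    show "f \<in> N" using f VC S(2) by (auto simp: N_def)
    show "N \<subseteq> sup.mball f r"
    proof
      fix g assume "g \<in> N"
      then have g: "g \<in> maps" "\<And>z. z \<in> S \<Longrightarrow> g ` C z \<subseteq> mball (f z) e" by (auto simp: N_def)
      have "sup_dist f g \<le> 2 * e"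
      proof (rule sup_dist_least)
        fix w assume w: "w \<in> topspace Z"
        then obtain z where z: "z \<in> S" "w \<in> V z" using cov by blast
        then have "w \<in> C z" "f ` C z \<subseteq> mball (f z) e" using VC S(2) by blast+
        then have "f w \<in> mball (f z) e" "g w \<in> mball (f z) e" using g(2)[OF z(1)] by blast+
        then have "d (f w) (g w) < 2 * e"
          using triangle[of "f w" "f z" "g w"] by (auto simp: commute)
        then show "min 1 (d (f w) (g w)) \<le> 2 * e" by linarith
      qed (use e in simp)
      then show "g \<in> sup.mball f r"
        using f g(1) r by (simp add: e_def)
    qed
  qed
qed

text \<open>One inclusion is continuity of the identity, tested on subbasic sets; the other finds a
  compact-open neighbourhood inside each ball.\<close>

lemma compact_open_eq_sup_mtopology:
  assumes "compact_space Z" "regular_space Z"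
  shows "compact_open Z mtopology = sup.mtopology"
proof (rule topology_eq[THEN iffD2], intro allI iffI)
  fix U
  assume "openin (compact_open Z mtopology) U"
  moreover have "continuous_map sup.mtopology (compact_open Z mtopology) id"
    by (rule continuous_map_into_compact_open) (simp_all add: openin_sup_mtopology)
  ultimately have "openin sup.mtopology {f \<in> maps. f \<in> U}"
    using openin_continuous_map_preimage[of sup.mtopology "compact_open Z mtopology" id U] by simp
  moreover have "{f \<in> maps. f \<in> U} = U"
    using openin_subset[OF \<open>openin (compact_open Z mtopology) U\<close>] by blast
  ultimately show "openin sup.mtopology U" by simp
next
  fix U
  assume U: "openin sup.mtopology U"
  show "openin (compact_open Z mtopology) U"
  proof (subst openin_subopen, intro ballI)
    fix f assume "f \<in> U"
    then obtain r where "r > 0" "sup.mball f r \<subseteq> U" "f \<in> maps"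
      using U unfolding sup.openin_mtopology by blast
    then obtain N where "openin (compact_open Z mtopology) N" "f \<in> N" "N \<subseteq> sup.mball f r"
      using compact_open_nbhd[OF assms] by metis
    then show "\<exists>N. openin (compact_open Z mtopology) N \<and> f \<in> N \<and> N \<subseteq> U"
      using \<open>sup.mball f r \<subseteq> U\<close> by blast
  qed
qed

lemma metrizable_compact_open_mtopology:
  assumes "compact_space Z" "regular_space Z"
  shows "metrizable_space (compact_open Z mtopology)"
  by (rule ssubst[OF compact_open_eq_sup_mtopology[OF assms], where P = metrizable_space])
    (rule sup.metrizable_space_mtopology)

end

lemma metrizable_compact_open:
  assumes "compact_space Z" "regular_space Z" "metrizable_space X"
  shows "metrizable_space (compact_open Z X)"
proof -
  obtain M d where "Metric_space M d" and X: "X = Metric_space.mtopology M d"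
    using assms(3) unfolding metrizable_space_def by metis
  then have "sup_metric M d" by (simp only: sup_metric_def)
  from sup_metric.metrizable_compact_open_mtopology[OF this assms(1,2)]
  show ?thesis by (simp only: X)
qed

lemma metrizable_loop_space:
  assumes "metrizable_space X"
  shows "metrizable_space (loop_space X x0)"
proof -
  have "compact_space (top_of_set {0..1::real})"
    by (rule compact_space_subtopology) simp
  moreover have "regular_space (top_of_set {0..1::real})"
    by (rule metrizable_imp_regular_space[OF metrizable_space_subtopology[OF metrizable_space_euclidean]])
  ultimately show ?thesis
    unfolding loop_space_def
    by (rule metrizable_space_subtopology[OF metrizable_compact_open[OF _ _ assms]])
qed

section \<open>Homotopies of loops and the group structure\<close>

abbreviation loop_homotopic :: "'a topology \<Rightarrow> 'a \<Rightarrow> (real \<Rightarrow> 'a) \<Rightarrow> (real \<Rightarrow> 'a) \<Rightarrow> bool" where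
  "loop_homotopic X x0 \<equiv> homotopic_with (\<lambda>\<gamma>. \<gamma> 0 = x0 \<and> \<gamma> 1 = x0) (top_of_set {0..1}) X"

lemma loop_class_eq_iff:
  assumes "\<alpha> \<in> loops X x0" "\<beta> \<in> loops X x0"
  shows "loop_class X x0 \<alpha> = loop_class X x0 \<beta> \<longleftrightarrow> loop_homotopic X x0 \<alpha> \<beta>"
proof
  have "\<beta> \<in> loop_class X x0 \<beta>"
    using assms(2) by (auto simp: loop_class_def loops_def pathin_def)
  moreover assume "loop_class X x0 \<alpha> = loop_class X x0 \<beta>"
  ultimately have "\<beta> \<in> loop_class X x0 \<alpha>" by (simp only:)
  then show "loop_homotopic X x0 \<alpha> \<beta>" by (simp add: loop_class_def)
next
  assume \<alpha>\<beta>: "loop_homotopic X x0 \<alpha> \<beta>"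
  have "loop_homotopic X x0 \<alpha> \<gamma> \<longleftrightarrow> loop_homotopic X x0 \<beta> \<gamma>" for \<gamma>
    by (rule iffI) (erule homotopic_with_trans[OF homotopic_with_symD[OF \<alpha>\<beta>]], erule homotopic_with_trans[OF \<alpha>\<beta>])
  then show "loop_class X x0 \<alpha> = loop_class X x0 \<beta>"
    by (simp only: loop_class_def)
qed

text \<open>The pasting lemma with a parameter space \<open>T\<close>. With \<open>T\<close> the
  unit interval of times it concatenates two homotopies.\<close>

lemma continuous_map_concat:
  fixes h k :: "'b \<times> real \<Rightarrow> 'a"
  assumes h: "continuous_map (prod_topology T (top_of_set {0..1})) X h"
    and k: "continuous_map (prod_topology T (top_of_set {0..1})) X k"
    and hk: "\<And>t. t \<in> topspace T \<Longrightarrow> h (t, 1) = k (t, 0)"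
  shows "continuous_map (prod_topology T (top_of_set {0..1})) X
    (\<lambda>y. if snd y \<le> 1/2 then (h \<circ> (\<lambda>y. (fst y, 2 * snd y))) y else (k \<circ> (\<lambda>y. (fst y, 2 * snd y - 1))) y)"
proof -
  let ?T = "prod_topology T (top_of_set {0..1::real})"
  have snd: "continuous_map ?T euclideanreal snd"
    using continuous_map_snd continuous_map_in_subtopology by blast
  have fst: "continuous_map ?T T fst" by (rule continuous_map_fst)
  show ?thesis
  proof (rule continuous_map_cases_le[OF snd])
    show "continuous_map ?T euclideanreal (\<lambda>y. 1/2)" by simp
    show "continuous_map (subtopology ?T {y \<in> topspace ?T. snd y \<le> 1/2}) X (h \<circ> (\<lambda>y. (fst y, 2 * snd y)))"
      by (intro continuous_map_compose[OF _ h] continuous_map_pairedI continuous_map_into_subtopology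
          continuous_map_from_subtopology[OF fst] continuous_map_real_mult continuous_map_from_subtopology[OF snd]) auto
    show "continuous_map (subtopology ?T {y \<in> topspace ?T. 1/2 \<le> snd y}) X (k \<circ> (\<lambda>y. (fst y, 2 * snd y - 1)))"
      by (intro continuous_map_compose[OF _ k] continuous_map_pairedI continuous_map_into_subtopology continuous_map_diff
          continuous_map_from_subtopology[OF fst] continuous_map_real_mult continuous_map_from_subtopology[OF snd]) auto
    show "(h \<circ> (\<lambda>y. (fst y, 2 * snd y))) y = (k \<circ> (\<lambda>y. (fst y, 2 * snd y - 1))) y"
      if "y \<in> topspace ?T" "snd y = 1/2" for y
      using that hk[of "fst y"] by (auto simp: mult.commute[of 2])
  qed
qed

lemma loop_homotopic_concat:
  assumes "loop_homotopic X x0 \<alpha> \<alpha>'" "loop_homotopic X x0 \<beta> \<beta>'"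
  shows "loop_homotopic X x0 (loop_concat \<alpha> \<beta>) (loop_concat \<alpha>' \<beta>')"
proof -
  let ?T = "prod_topology (top_of_set {0..1::real}) (top_of_set {0..1::real})"
  obtain h where h: "continuous_map ?T X h" "\<And>s. h (0, s) = \<alpha> s" "\<And>s. h (1, s) = \<alpha>' s"
      "\<And>t. t \<in> {0..1} \<Longrightarrow> h (t, 0) = x0 \<and> h (t, 1) = x0"
    using assms(1) unfolding homotopic_with_def by metis
  obtain k where k: "continuous_map ?T X k" "\<And>s. k (0, s) = \<beta> s" "\<And>s. k (1, s) = \<beta>' s"
      "\<And>t. t \<in> {0..1} \<Longrightarrow> k (t, 0) = x0 \<and> k (t, 1) = x0"
    using assms(2) unfolding homotopic_with_def by metis
  define H where "H y = (if snd y \<le> 1/2 then (h \<circ> (\<lambda>y. (fst y, 2 * snd y))) y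
      else (k \<circ> (\<lambda>y. (fst y, 2 * snd y - 1))) y)" for y
  have "continuous_map ?T X H"
    unfolding H_def by (rule continuous_map_concat[OF h(1) k(1)]) (simp add: h(4) k(4))
  then show ?thesis
    \<comment> \<open>This form of \<open>homotopic_with\<close> compares \<open>H\<close> with the
      loops only on \<open>{0..1}\<close>, which matters as \<open>H\<close> is not extensional;
      \<open>force\<close> checks that the endpoint condition depends only on values there.\<close>
    by (subst homotopic_with, force, intro exI[of _ H]) (auto simp: H_def loop_concat_def h k)
qed

text \<open>A loop is homotopic to itself, and a self-homotopy of the concatenation entails its
  continuity and its endpoint values.\<close>

lemma loop_concat_in_loops:
  assumes "\<alpha> \<in> loops X x0" "\<beta> \<in> loops X x0"
  shows "loop_concat \<alpha> \<beta> \<in> loops X x0"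
proof -
  have "loop_homotopic X x0 (loop_concat \<alpha> \<beta>) (loop_concat \<alpha> \<beta>)"
    using assms by (intro loop_homotopic_concat) (auto simp: loops_def pathin_def)
  then show ?thesis
    by (auto simp: loops_def pathin_def loop_concat_def)
qed

text \<open>Both loops are \<open>\<alpha>\<close> after a self-map of the interval. The
  straight-line homotopy from \<open>f\<close> to \<open>g\<close> stays in the convex set
  \<open>{0..1}\<close> and is constant at the ends, where \<open>f\<close> and \<open>g\<close>
  agree. The group laws below are instances.\<close>

lemma loop_homotopic_reparam:
  assumes \<alpha>: "\<alpha> \<in> loops X x0" and \<beta>: "\<beta> \<in> loops X x0" and \<gamma>: "\<gamma> \<in> loops X x0"
    and f: "continuous_on {0..1} f" "f ` {0..1} \<subseteq> {0..1}" "\<And>s. s \<in> {0..1} \<Longrightarrow> \<beta> s = \<alpha> (f s)"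
    and g: "continuous_on {0..1} g" "g ` {0..1} \<subseteq> {0..1}" "\<And>s. s \<in> {0..1} \<Longrightarrow> \<gamma> s = \<alpha> (g s)"
    and fg: "f 0 = g 0" "f 1 = g 1"
  shows "loop_homotopic X x0 \<beta> \<gamma>"
proof -
  let ?T = "prod_topology (top_of_set {0..1::real}) (top_of_set {0..1::real})"
  define F where "F y = (1 - fst y) * f (snd y) + fst y * g (snd y)" for y :: "real \<times> real"
  have "F y \<in> {0..1}" if "y \<in> {0..1} \<times> {0..1}" for y
  proof -
    have "f (snd y) \<in> {0..1}" "g (snd y) \<in> {0..1}" "fst y \<in> {0..1}" 
      using that f(2) g(2) by (auto simp: image_subset_iff)
    then show ?thesis
      unfolding F_def using convex_bound_le[of "f (snd y)" 1 "g (snd y)" "1 - fst y" "fst y"] by auto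
  qed
  moreover have "continuous_on ({0..1} \<times> {0..1}) F"
    unfolding F_def
    by (intro continuous_intros continuous_on_compose2[OF f(1)] continuous_on_compose2[OF g(1)]) auto
  ultimately have F: "continuous_map ?T (top_of_set {0..1}) F"
    by (intro continuous_map_into_subtopology) auto
  have "continuous_map ?T X (\<alpha> \<circ> F)"
    using \<alpha> by (intro continuous_map_compose[OF F]) (simp add: loops_def pathin_def)
  \<comment> \<open>\<open>f\<close> and \<open>g\<close> may send the ends anywhere (both go to
    \<open>1\<close> in the inverse law), so the values of \<open>\<alpha>\<close> there are read
    off from \<open>\<beta>\<close>.\<close>
  moreover have "\<beta> 0 = x0" "\<beta> 1 = x0" using \<beta> by (auto simp: loops_def)
  then have "\<alpha> (g 0) = x0" "\<alpha> (g 1) = x0" using f(3)[of 0] f(3)[of 1] fg by auto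
  ultimately show ?thesis
    by (subst homotopic_with, force, intro exI[of _ "\<alpha> \<circ> F"])
      (auto simp: F_def f(3) g(3) fg algebra_simps)
qed

definition loop_reverse :: "(real \<Rightarrow> 'a) \<Rightarrow> (real \<Rightarrow> 'a)" where
  "loop_reverse \<alpha> = (\<lambda>s\<in>{0..1}. \<alpha> (1 - s))"

lemma loop_reverse_in_loops:
  assumes "\<alpha> \<in> loops X x0"
  shows "loop_reverse \<alpha> \<in> loops X x0"
proof -
  have "continuous_map (top_of_set {0..1}) (top_of_set {0..1::real}) (\<lambda>s. 1 - s)"
    by (auto simp: continuous_map_in_subtopology intro!: continuous_intros)
  then have "continuous_map (top_of_set {0..1}) X (\<alpha> \<circ> (\<lambda>s. 1 - s))"
    using assms by (intro continuous_map_compose[of _ "top_of_set {0..1}"]) (auto simp: loops_def pathin_def)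
  then have "continuous_map (top_of_set {0..1}) X (loop_reverse \<alpha>)"
    by (rule continuous_map_eq) (auto simp: loop_reverse_def)
  then show ?thesis
    using assms by (auto simp: loops_def pathin_def loop_reverse_def)
qed

lemma const_in_loops: "x0 \<in> topspace X \<Longrightarrow> (\<lambda>s\<in>{0..1}. x0) \<in> loops X x0"
  using continuous_map_eq[of "top_of_set {0..1}" X "\<lambda>_. x0" "\<lambda>s\<in>{0..1}. x0"]
  by (simp add: loops_def pathin_def)

text \<open>
  The reparametrization maps \<open>[0, 1/4]\<close>, \<open>[1/4, 1/2]\<close>, \<open>[1/2, 1]\<close> affinely onto
  \<open>[0, 1/2]\<close>, \<open>[1/2, 3/4]\<close>, \<open>[3/4, 1]\<close>; being concave, it is the minimum of its three affine pieces.
\<close>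

lemma loop_homotopic_assoc:
  assumes "\<alpha> \<in> loops X x0" "\<beta> \<in> loops X x0" "\<gamma> \<in> loops X x0"
  shows "loop_homotopic X x0 (loop_concat (loop_concat \<alpha> \<beta>) \<gamma>) (loop_concat \<alpha> (loop_concat \<beta> \<gamma>))"
proof (rule loop_homotopic_reparam[where g = id and
      f = "\<lambda>s. min (2 * s) (min (s + 1/4) (s/2 + 1/2))"])
  let ?f = "\<lambda>s::real. min (2 * s) (min (s + 1/4) (s/2 + 1/2))"
  show "loop_concat (loop_concat \<alpha> \<beta>) \<gamma> s = loop_concat \<alpha> (loop_concat \<beta> \<gamma>) (?f s)"
    if s: "s \<in> {0..1}" for s
  proof -
    consider "s \<le> 1/4" | "1/4 < s" "s \<le> 1/2" | "1/2 < s" by linarith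
    then show ?thesis
    proof cases
      case 1
      then have "?f s = 2 * s" by simp
      then show ?thesis using 1 s by (simp add: loop_concat_def)
    next
      case 2
      then have "?f s = s + 1/4" by simp
      then show ?thesis using 2 s by (simp add: loop_concat_def algebra_simps)
    next
      case 3
      then have "?f s = s/2 + 1/2" by simp
      then show ?thesis using 3 s by (simp add: loop_concat_def algebra_simps)
    qed
  qed
qed (use assms in \<open>auto simp: loop_concat_in_loops intro!: continuous_intros\<close>)

text \<open>The reparametrization waits at \<open>0\<close> during the first half and then runs
  through the interval at double speed.\<close>

lemma loop_homotopic_left_unit:
  assumes "\<alpha> \<in> loops X x0" "x0 \<in> topspace X"
  shows "loop_homotopic X x0 (loop_concat (\<lambda>s\<in>{0..1}. x0) \<alpha>) \<alpha>"
proof (rule loop_homotopic_reparam[OF assms(1), where g = id and f = "\<lambda>s. max 0 (2 * s - 1)"])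
  have ends: "\<alpha> 0 = x0" "\<alpha> 1 = x0" using assms by (auto simp: loops_def)
  show "loop_concat (\<lambda>s\<in>{0..1}. x0) \<alpha> s = \<alpha> (max 0 (2 * s - 1))" if "s \<in> {0..1}" for s
    using that ends by (cases s "1/2 :: real" rule: linorder_cases) (auto simp: loop_concat_def max_def mult.commute[of 2])
qed (use assms in \<open>auto simp: loop_concat_in_loops const_in_loops intro!: continuous_intros\<close>)

text \<open>The reparametrization \<open>\<bar>2 * s - 1\<bar>\<close> runs from \<open>1\<close>
  down to \<open>0\<close> and back, so it agrees at both ends with the constant map
  \<open>1\<close>, which turns \<open>\<alpha>\<close> into the constant loop.\<close>

lemma loop_homotopic_left_inverse:
  assumes "\<alpha> \<in> loops X x0" "x0 \<in> topspace X"
  shows "loop_homotopic X x0 (loop_concat (loop_reverse \<alpha>) \<alpha>) (\<lambda>s\<in>{0..1}. x0)"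
proof (rule loop_homotopic_reparam[OF assms(1), where g = "\<lambda>_. 1" and f = "\<lambda>s. \<bar>2 * s - 1\<bar>"])
  show "loop_concat (loop_reverse \<alpha>) \<alpha> s = \<alpha> \<bar>2 * s - 1\<bar>" if "s \<in> {0..1}" for s
    using that by (cases s "1/2 :: real" rule: linorder_cases)
      (auto simp: loop_concat_def loop_reverse_def abs_if mult.commute[of 2])
  show "(\<lambda>s\<in>{0..1}. x0) s = \<alpha> 1" if "s \<in> {0..1}" for s :: real
    using that assms by (auto simp: loops_def)
qed (use assms in \<open>auto simp: loop_concat_in_loops loop_reverse_in_loops const_in_loops intro!: continuous_intros\<close>)

lemma carrier_fundamental_group [simp]:
  "carrier (fundamental_group X x0) = loop_class X x0 ` loops X x0"
  by (simp add: fundamental_group_def)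

lemma one_fundamental_group:
  "\<one>\<^bsub>fundamental_group X x0\<^esub> = loop_class X x0 (\<lambda>s\<in>{0..1}. x0)"
  by (simp add: fundamental_group_def)

text \<open>Homotopic representatives have homotopic concatenations, so the union in the definition
  runs over equal sets; it collapses to that set because both classes are nonempty.\<close>

lemma mult_fundamental_group:
  assumes \<alpha>: "\<alpha> \<in> loops X x0" and \<beta>: "\<beta> \<in> loops X x0"
  shows "loop_class X x0 \<alpha> \<otimes>\<^bsub>fundamental_group X x0\<^esub> loop_class X x0 \<beta> = loop_class X x0 (loop_concat \<alpha> \<beta>)"
proof -
  have "\<alpha> \<in> loop_class X x0 \<alpha>" "\<beta> \<in> loop_class X x0 \<beta>"
    using assms by (auto simp: loop_class_def loops_def pathin_def)
  then have ne: "loop_class X x0 \<alpha> \<noteq> {}" "loop_class X x0 \<beta> \<noteq> {}" by blast+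
  have eq: "loop_class X x0 (loop_concat \<alpha>' \<beta>') = loop_class X x0 (loop_concat \<alpha> \<beta>)"
    if "\<alpha>' \<in> loop_class X x0 \<alpha>" "\<beta>' \<in> loop_class X x0 \<beta>" for \<alpha>' \<beta>'
  proof -
    have "\<alpha>' \<in> loops X x0" "\<beta>' \<in> loops X x0" using that by (auto simp: loop_class_def)
    moreover have "loop_homotopic X x0 (loop_concat \<alpha>' \<beta>') (loop_concat \<alpha> \<beta>)"
      using that by (intro loop_homotopic_concat) (auto simp: loop_class_def intro: homotopic_with_symD)
    ultimately show ?thesis
      using assms by (simp add: loop_class_eq_iff loop_concat_in_loops)
  qed
  have "(\<Union>\<alpha>'\<in>loop_class X x0 \<alpha>. \<Union>\<beta>'\<in>loop_class X x0 \<beta>. loop_class X x0 (loop_concat \<alpha>' \<beta>'))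
      = (\<Union>\<alpha>'\<in>loop_class X x0 \<alpha>. \<Union>\<beta>'\<in>loop_class X x0 \<beta>. loop_class X x0 (loop_concat \<alpha> \<beta>))"
    by (intro SUP_cong refl eq)
  also have "\<dots> = loop_class X x0 (loop_concat \<alpha> \<beta>)"
    using ne by simp
  finally show ?thesis
    by (simp add: fundamental_group_def)
qed

text \<open>Each law is a homotopy between representatives; \<open>groupI\<close> derives the
  right-hand unit and inverse laws from the left-hand ones.\<close>

lemma group_fundamental_group:
  assumes x0: "x0 \<in> topspace X"
  shows "group (fundamental_group X x0)"
proof (rule groupI)
  let ?G = "fundamental_group X x0" and ?c = "loop_class X x0"
  have rep: "\<exists>\<alpha>\<in>loops X x0. x = ?c \<alpha>" if "x \<in> carrier ?G" for x
    using that by auto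
  show "x \<otimes>\<^bsub>?G\<^esub> y \<in> carrier ?G" if xy: "x \<in> carrier ?G" "y \<in> carrier ?G" for x y
  proof -
    obtain \<alpha> \<beta> where ab: "\<alpha> \<in> loops X x0" "\<beta> \<in> loops X x0" "x = ?c \<alpha>" "y = ?c \<beta>"
      using rep xy by metis
    then show ?thesis
      by (simp only: mult_fundamental_group carrier_fundamental_group loop_concat_in_loops imageI)
  qed
  show "\<one>\<^bsub>?G\<^esub> \<in> carrier ?G"
    by (simp only: one_fundamental_group carrier_fundamental_group const_in_loops[OF x0] imageI)
  show "x \<otimes>\<^bsub>?G\<^esub> y \<otimes>\<^bsub>?G\<^esub> z = x \<otimes>\<^bsub>?G\<^esub> (y \<otimes>\<^bsub>?G\<^esub> z)"
    if xyz: "x \<in> carrier ?G" "y \<in> carrier ?G" "z \<in> carrier ?G" for x y z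
  proof -
    obtain \<alpha> \<beta> \<gamma> where abc: "\<alpha> \<in> loops X x0" "\<beta> \<in> loops X x0" "\<gamma> \<in> loops X x0"
        "x = ?c \<alpha>" "y = ?c \<beta>" "z = ?c \<gamma>"
      using rep xyz by metis
    then show ?thesis
      by (simp only: mult_fundamental_group loop_concat_in_loops loop_class_eq_iff loop_homotopic_assoc)
  qed
  show "\<one>\<^bsub>?G\<^esub> \<otimes>\<^bsub>?G\<^esub> x = x" if x: "x \<in> carrier ?G" for x
  proof -
    obtain \<alpha> where a: "\<alpha> \<in> loops X x0" "x = ?c \<alpha>"
      using rep x by metis
    then show ?thesis
      by (simp only: mult_fundamental_group one_fundamental_group loop_concat_in_loops
          const_in_loops[OF x0] loop_class_eq_iff loop_homotopic_left_unit x0)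
  qed
  show "\<exists>y\<in>carrier ?G. y \<otimes>\<^bsub>?G\<^esub> x = \<one>\<^bsub>?G\<^esub>" if x: "x \<in> carrier ?G" for x
  proof -
    obtain \<alpha> where a: "\<alpha> \<in> loops X x0" "x = ?c \<alpha>"
      using rep x by metis
    show ?thesis
    proof
      show "?c (loop_reverse \<alpha>) \<in> carrier ?G"
        using a by (simp only: carrier_fundamental_group loop_reverse_in_loops imageI)
      show "?c (loop_reverse \<alpha>) \<otimes>\<^bsub>?G\<^esub> x = \<one>\<^bsub>?G\<^esub>"
        using a by (simp only: mult_fundamental_group one_fundamental_group loop_reverse_in_loops
            loop_concat_in_loops const_in_loops[OF x0] loop_class_eq_iff loop_homotopic_left_inverse x0)
    qed
  qed
qed

lemma inv_fundamental_group:
  assumes \<alpha>: "\<alpha> \<in> loops X x0" and x0: "x0 \<in> topspace X"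
  shows "inv\<^bsub>fundamental_group X x0\<^esub> (loop_class X x0 \<alpha>) = loop_class X x0 (loop_reverse \<alpha>)"
  using assms
  by (intro group.inv_equality[OF group_fundamental_group[OF x0]])
    (auto simp: mult_fundamental_group one_fundamental_group loop_class_eq_iff loop_reverse_in_loops
      loop_concat_in_loops const_in_loops loop_homotopic_left_inverse)

section \<open>Continuity of concatenation and reversal of loops\<close>

lemma openin_loop_space_subbasic:
  assumes "compactin (top_of_set {0..1}) C" "openin X U"
  shows "openin (loop_space X x0) {\<alpha> \<in> loops X x0. \<alpha> ` C \<subseteq> U}"
proof -
  have "openin (loop_space X x0)
      ({f \<in> topspace (compact_open (top_of_set {0..1}) X). f ` C \<subseteq> U} \<inter> loops X x0)"
    unfolding loop_space_def by (intro openin_subtopology_Int openin_compact_open_subbasic assms)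
  moreover have "{f \<in> topspace (compact_open (top_of_set {0..1}) X). f ` C \<subseteq> U} \<inter> loops X x0
      = {\<alpha> \<in> loops X x0. \<alpha> ` C \<subseteq> U}"
    by (auto simp: topspace_compact_open loops_def pathin_def)
  ultimately show ?thesis by simp
qed

lemma continuous_map_into_loop_space:
  assumes F: "\<And>t. t \<in> topspace T \<Longrightarrow> F t \<in> loops X x0"
    and op: "\<And>C U. compact C \<Longrightarrow> C \<subseteq> {0..1} \<Longrightarrow> openin X U \<Longrightarrow> openin T {t \<in> topspace T. F t ` C \<subseteq> U}"
  shows "continuous_map T (loop_space X x0) F"
  unfolding loop_space_def
proof (rule continuous_map_into_subtopology[OF continuous_map_into_compact_open])
  show "F t \<in> topspace (compact_open (top_of_set {0..1}) X)" if "t \<in> topspace T" for t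
    using F[OF that] by (auto simp: topspace_compact_open loops_def pathin_def)
  show "openin T {t \<in> topspace T. F t ` C \<subseteq> U}"
    if "compactin (top_of_set {0..1}) C" "openin X U" for C U
    using that by (intro op) (simp_all add: compactin_subtopology)
qed (use F in blast)

text \<open>A concatenation sends \<open>C\<close> into \<open>U\<close> exactly when
  \<open>\<alpha>\<close> and \<open>\<beta>\<close> send the two rescaled halves of
  \<open>C\<close> into \<open>U\<close>, so the preimage of a subbasic set is an open
  rectangle.\<close>

lemma continuous_map_loop_concat:
  "continuous_map (prod_topology (loop_space X x0) (loop_space X x0)) (loop_space X x0)
    (\<lambda>(\<alpha>, \<beta>). loop_concat \<alpha> \<beta>)"
proof (rule continuous_map_into_loop_space)
  show "(case z of (\<alpha>, \<beta>) \<Rightarrow> loop_concat \<alpha> \<beta>) \<in> loops X x0"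
    if "z \<in> topspace (prod_topology (loop_space X x0) (loop_space X x0))" for z
    using that by (auto simp: loop_concat_in_loops)
next
  fix C :: "real set" and U
  assume C: "compact C" "C \<subseteq> {0..1}" and U: "openin X U"
  \<comment> \<open>Both halves keep the point \<open>1/2\<close>, so they stay compact; the two
    formulas agree there because \<open>\<alpha> 1 = \<beta> 0\<close>.\<close>
  define C1 where "C1 = (\<lambda>s. 2 * s) ` (C \<inter> {..1/2})"
  define C2 where "C2 = (\<lambda>s. 2 * s - 1) ` (C \<inter> {1/2..})"
  have "compact C1" "compact C2"
    unfolding C1_def C2_def using C(1)
    by (auto intro!: compact_continuous_image continuous_intros compact_Int_closed)
  moreover have sub: "C1 \<subseteq> {0..1}" "C2 \<subseteq> {0..1}"
    using C(2) by (auto simp: C1_def C2_def)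
  ultimately have cpt: "compactin (top_of_set {0..1}) C1" "compactin (top_of_set {0..1}) C2"
    by (simp_all add: compactin_subtopology)
  have iff: "loop_concat \<alpha> \<beta> ` C \<subseteq> U \<longleftrightarrow> \<alpha> ` C1 \<subseteq> U \<and> \<beta> ` C2 \<subseteq> U"
    if "\<alpha> \<in> loops X x0" "\<beta> \<in> loops X x0" for \<alpha> \<beta>
  proof -
    have ends: "\<alpha> 1 = \<beta> 0" using that by (simp add: loops_def)
    have "loop_concat \<alpha> \<beta> s = \<alpha> (2 * s)" if "s \<in> C \<inter> {..1/2}" for s
      using that C(2) by (auto simp: loop_concat_def)
    then have 1: "\<alpha> ` C1 = loop_concat \<alpha> \<beta> ` (C \<inter> {..1/2})"
      unfolding C1_def image_image by (intro image_cong refl) simp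
    have "loop_concat \<alpha> \<beta> s = \<beta> (2 * s - 1)" if s: "s \<in> C \<inter> {1/2..}" for s
    proof (cases "s = 1/2")
      case True
      then have "2 * s = 1" "2 * s - 1 = 0" by simp_all
      then show ?thesis using s C(2) ends by (auto simp: loop_concat_def)
    next
      case False
      then have "\<not> s \<le> 1/2" using s by auto
      then show ?thesis using s C(2) by (auto simp: loop_concat_def)
    qed
    then have 2: "\<beta> ` C2 = loop_concat \<alpha> \<beta> ` (C \<inter> {1/2..})"
      unfolding C2_def image_image by (intro image_cong refl) simp
    have "C = (C \<inter> {..1/2}) \<union> (C \<inter> {1/2..})" by auto
    then have "loop_concat \<alpha> \<beta> ` C = \<alpha> ` C1 \<union> \<beta> ` C2"
      unfolding 1 2 by (metis image_Un)
    then show ?thesis by simp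
  qed
  have "openin (prod_topology (loop_space X x0) (loop_space X x0))
      ({\<alpha> \<in> loops X x0. \<alpha> ` C1 \<subseteq> U} \<times> {\<beta> \<in> loops X x0. \<beta> ` C2 \<subseteq> U})"
    using cpt U by (simp add: openin_prod_Times_iff openin_loop_space_subbasic)
  moreover have "{\<alpha> \<in> loops X x0. \<alpha> ` C1 \<subseteq> U} \<times> {\<beta> \<in> loops X x0. \<beta> ` C2 \<subseteq> U} =
      {z \<in> topspace (prod_topology (loop_space X x0) (loop_space X x0)).
        (case z of (\<alpha>, \<beta>) \<Rightarrow> loop_concat \<alpha> \<beta>) ` C \<subseteq> U}"
    by (rule Set.set_eqI) (auto simp: iff simp del: image_subset_iff del: image_subsetI subsetI)
  ultimately show "openin (prod_topology (loop_space X x0) (loop_space X x0))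
      {z \<in> topspace (prod_topology (loop_space X x0) (loop_space X x0)).
        (case z of (\<alpha>, \<beta>) \<Rightarrow> loop_concat \<alpha> \<beta>) ` C \<subseteq> U}"
    by simp
qed

lemma continuous_map_loop_reverse:
  "continuous_map (loop_space X x0) (loop_space X x0) loop_reverse"
proof (rule continuous_map_into_loop_space)
  show "loop_reverse \<alpha> \<in> loops X x0" if "\<alpha> \<in> topspace (loop_space X x0)" for \<alpha>
    using that by (simp add: loop_reverse_in_loops)
next
  fix C :: "real set" and U
  assume C: "compact C" "C \<subseteq> {0..1}" and U: "openin X U"
  have "loop_reverse \<alpha> ` C = \<alpha> ` (\<lambda>s. 1 - s) ` C" for \<alpha> :: "real \<Rightarrow> 'a"
    unfolding image_image using C(2) by (intro image_cong refl) (auto simp: loop_reverse_def)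
  moreover have "compact ((\<lambda>s. 1 - s) ` C)"
    using C(1) by (auto intro!: compact_continuous_image continuous_intros)
  then have "compactin (top_of_set {0..1}) ((\<lambda>s. 1 - s) ` C)"
    using C(2) by (auto simp: compactin_subtopology)
  ultimately show "openin (loop_space X x0) {\<alpha> \<in> topspace (loop_space X x0). loop_reverse \<alpha> ` C \<subseteq> U}"
    using openin_loop_space_subbasic[OF _ U] by simp
qed

section \<open>Quotient maps and k-closed sets\<close>

lemma closedin_quotient_map_preimage:
  assumes "quotient_map X Y f" "C \<subseteq> topspace Y" "closedin X {x \<in> topspace X. f x \<in> C}"
  shows "closedin Y C"
  using assms by (simp add: quotient_map_closedin)

text \<open>In a \<open>k_space\<close> the preimage of \<open>A\<close> may be tested on compact
  subspaces. These are compact Hausdorff, and \<open>q\<close> restricted to one of them is a test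
  map for \<open>A\<close>, whatever the type of its points.\<close>

lemma compactly_generated_quotient:
  assumes q: "quotient_map Y Q q" and Y: "k_space Y" "Hausdorff_space Y"
  shows "compactly_generated Q"
  unfolding compactly_generated_def
proof (intro allI impI)
  fix A assume A: "k_closed Q A"
  then have AQ: "A \<subseteq> topspace Q" by (simp add: k_closed_def)
  have "closedin Y {y \<in> topspace Y. q y \<in> A}"
  proof (rule k_space[THEN iffD1, OF Y(1), rule_format], intro conjI allI impI)
    fix C assume C: "compactin Y C"
    have "closedin (subtopology Y C) {y \<in> topspace (subtopology Y C). q y \<in> A}"
      using C Y(2) q by (intro k_closed_imp_closedin_preimage[OF A] compact_space_subtopology
          Hausdorff_space_subtopology continuous_map_from_subtopology quotient_imp_continuous_map)
    moreover have "{y \<in> topspace (subtopology Y C). q y \<in> A} = C \<inter> {y \<in> topspace Y. q y \<in> A}"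
      by auto
    ultimately show "closedin (subtopology Y C) (C \<inter> {y \<in> topspace Y. q y \<in> A})" by simp
  qed auto
  then show "closedin Q A"
    by (rule closedin_quotient_map_preimage[OF q AQ])
qed

text \<open>A product of two quotient maps need not be a quotient map, so closedness of
  \<open>S\<close> cannot be expected. A test map from a compact Hausdorff \<open>K\<close> supplies
  a compact factor, over which \<open>p\<close> and \<open>q\<close> can be divided out one at a
  time. The assumptions on \<open>A\<close> make \<open>A \<times> K\<close> a
  \<open>k_space\<close> whose compact subspaces are Hausdorff.\<close>

lemma k_closed_prod_quotient:
  fixes A' :: "'c topology" and B' :: "'d topology"
  assumes p: "quotient_map A A' p" and q: "quotient_map B B' q"
    and A: "k_space A" "Hausdorff_space A"
    and S: "S \<subseteq> topspace (prod_topology A' B')"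
    and cl: "closedin (prod_topology A B) {z \<in> topspace (prod_topology A B). (p (fst z), q (snd z)) \<in> S}"
  shows "k_closed (prod_topology A' B') S"
  unfolding k_closed_def
proof (intro conjI allI impI S)
  fix K :: "('c \<times> 'd) set set list set topology" and t
  assume "compact_space K \<and> Hausdorff_space K \<and> continuous_map K (prod_topology A' B') t"
  then have K: "compact_space K" "Hausdorff_space K" and t: "continuous_map K (prod_topology A' B') t"
    by auto
  have lcK: "locally_compact_space K" using K(1) by (rule compact_imp_locally_compact_space)
  have kAK: "k_space (prod_topology A K)"
    using A(1) lcK K(2) by (intro k_space_prod_topology_right) auto
  have t1: "continuous_map K A' (fst \<circ> t)" and t2: "continuous_map K B' (snd \<circ> t)"
    by (rule continuous_map_compose[OF t continuous_map_fst],
        rule continuous_map_compose[OF t continuous_map_snd])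
  \<comment> \<open>\<open>A \<times> K\<close> is a \<open>k_space\<close>, so \<open>D\<close> may be tested on compact subspaces \<open>L\<close>, over which \<open>q\<close> can be
    divided out; afterwards \<open>p\<close> is divided out over \<open>K\<close>.\<close>
  define D where "D = {z \<in> topspace (prod_topology A K). (p (fst z), snd (t (snd z))) \<in> S}"
  have "closedin (prod_topology A K) D"
  proof (rule k_space[THEN iffD1, OF kAK, rule_format], intro conjI allI impI)
    show "D \<subseteq> topspace (prod_topology A K)" by (auto simp: D_def)
  next
    fix C assume C: "compactin (prod_topology A K) C"
    define L where "L = subtopology (prod_topology A K) C"
    have L: "compact_space L" "Hausdorff_space L"
      using C A(2) K(2) by (auto simp: L_def compact_space_subtopology Hausdorff_space_prod_topology
          intro!: Hausdorff_space_subtopology)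
    have u: "continuous_map L A fst" and v: "continuous_map L B' (snd \<circ> t \<circ> snd)"
      unfolding L_def by (auto intro!: continuous_map_from_subtopology continuous_map_fst
          continuous_map_compose[OF continuous_map_snd t2])
    \<comment> \<open>Here the second coordinate is freed from \<open>t\<close>: the pullback of
      \<open>?E\<close> along \<open>id \<times> q\<close> is a continuous preimage of the closed
      set in \<open>cl\<close>, and then descends along the quotient map
      \<open>L \<times> B \<rightarrow> L \<times> B'\<close>.\<close>
    let ?E = "{z \<in> topspace (prod_topology L B'). (p (fst (fst z)), snd z) \<in> S}"
    have "closedin (prod_topology L B) {z \<in> topspace (prod_topology L B). (fst (fst z), snd z) \<in>
        {z \<in> topspace (prod_topology A B). (p (fst z), q (snd z)) \<in> S}}"
      using u by (intro closedin_continuous_map_preimage[OF _ cl] continuous_map_pairedI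
          continuous_map_snd continuous_map_compose[OF continuous_map_fst, unfolded o_def])
    moreover have "{z \<in> topspace (prod_topology L B). (fst (fst z), snd z) \<in>
        {z \<in> topspace (prod_topology A B). (p (fst z), q (snd z)) \<in> S}}
        = {z \<in> topspace (prod_topology L B). (case z of (x, y) \<Rightarrow> (x, q y)) \<in> ?E}"
      using quotient_imp_surjective_map[OF q] by (auto simp: L_def)
    ultimately have E: "closedin (prod_topology L B)
        {z \<in> topspace (prod_topology L B). (case z of (x, y) \<Rightarrow> (x, q y)) \<in> ?E}" by (simp only:)
    have "quotient_map (prod_topology L B) (prod_topology L B') (\<lambda>(x, y). (x, q y))"
      using L by (intro quotient_map_prod_right q compact_imp_locally_compact_space) auto
    from closedin_quotient_map_preimage[OF this _ E] have "closedin (prod_topology L B') ?E"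
      by blast
    \<comment> \<open>Pulling back along the graph of the second coordinate of \<open>t\<close>
      restores the dependence on \<open>K\<close> and yields the part of \<open>D\<close> in
      \<open>C\<close>.\<close>
    then have "closedin L {l \<in> topspace L. (l, (snd \<circ> t \<circ> snd) l) \<in> ?E}"
      using v by (intro closedin_continuous_map_preimage[of L "prod_topology L B'"] continuous_map_pairedI) (auto simp: o_def)
    moreover have "{l \<in> topspace L. (l, (snd \<circ> t \<circ> snd) l) \<in> ?E} = C \<inter> D"
      using compactin_subset_topspace[OF C] continuous_map_image_subset_topspace[OF v]
      by (auto simp: L_def D_def)
    ultimately show "closedin (subtopology (prod_topology A K) C) (C \<inter> D)"
      by (simp add: L_def)
  qed
  moreover have "D = {z \<in> topspace (prod_topology A K). (case z of (x, y) \<Rightarrow> (p x, y)) \<in>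
      {z \<in> topspace (prod_topology A' K). (fst z, snd (t (snd z))) \<in> S}}"
    using quotient_imp_surjective_map[OF p] by (auto simp: D_def)
  ultimately have D: "closedin (prod_topology A K)
      {z \<in> topspace (prod_topology A K). (case z of (x, y) \<Rightarrow> (p x, y)) \<in>
        {z \<in> topspace (prod_topology A' K). (fst z, snd (t (snd z))) \<in> S}}" by (simp only:)
  have "quotient_map (prod_topology A K) (prod_topology A' K) (\<lambda>(x, y). (p x, y))"
    using K lcK by (intro quotient_map_prod_left p) auto
  from closedin_quotient_map_preimage[OF this _ D]
  have "closedin (prod_topology A' K) {z \<in> topspace (prod_topology A' K). (fst z, snd (t (snd z))) \<in> S}"
    by blast
  \<comment> \<open>The same device for the first coordinate: the graph of
    \<open>fst \<circ> t\<close> pulls the set back to the preimage of \<open>S\<close> under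
    \<open>t\<close>.\<close>
  then have "closedin K {k \<in> topspace K. ((fst \<circ> t) k, k) \<in>
      {z \<in> topspace (prod_topology A' K). (fst z, snd (t (snd z))) \<in> S}}"
    using t1 by (intro closedin_continuous_map_preimage[of K "prod_topology A' K"] continuous_map_pairedI) (auto simp: o_def)
  moreover have "{k \<in> topspace K. ((fst \<circ> t) k, k) \<in>
      {z \<in> topspace (prod_topology A' K). (fst z, snd (t (snd z))) \<in> S}} = {k \<in> topspace K. t k \<in> S}"
    using continuous_map_image_subset_topspace[OF t1] by auto
  ultimately show "closedin K {k \<in> topspace K. t k \<in> S}" by simp
qed

section \<open>Continuity of the group operations on the quotient\<close>

lemma continuous_map_inv_pi1_qtop:
  assumes "x0 \<in> topspace X"
  shows "continuous_map (pi1_qtop X x0) (pi1_qtop X x0) (\<lambda>x. inv\<^bsub>fundamental_group X x0\<^esub> x)"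
proof (rule continuous_compose_quotient_map[OF quotient_map_loop_class])
  have "continuous_map (loop_space X x0) (pi1_qtop X x0) (loop_class X x0 \<circ> loop_reverse)"
    by (intro continuous_map_compose[OF continuous_map_loop_reverse]
        quotient_imp_continuous_map quotient_map_loop_class)
  then show "continuous_map (loop_space X x0) (pi1_qtop X x0)
      ((\<lambda>x. inv\<^bsub>fundamental_group X x0\<^esub> x) \<circ> loop_class X x0)"
    by (rule continuous_map_eq) (simp add: inv_fundamental_group assms)
qed

text \<open>On pairs of loops, multiplying the classes is concatenating and then taking the class,
  which is continuous, so the preimage of \<open>C\<close> is closed upstairs;
  \<open>k_closed_prod_quotient\<close> brings it down.\<close>

lemma k_closed_mult_preimage:
  assumes X: "metrizable_space X" and x0: "x0 \<in> topspace X" and C: "closedin (pi1_qtop X x0) C"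
  shows "k_closed (prod_topology (pi1_qtop X x0) (pi1_qtop X x0))
    {z \<in> topspace (prod_topology (pi1_qtop X x0) (pi1_qtop X x0)).
      (case z of (x, y) \<Rightarrow> x \<otimes>\<^bsub>fundamental_group X x0\<^esub> y) \<in> C}" (is "k_closed _ ?S")
proof (rule k_closed_prod_quotient[OF quotient_map_loop_class quotient_map_loop_class])
  let ?\<Omega> = "loop_space X x0"
  show "k_space ?\<Omega>" "Hausdorff_space ?\<Omega>"
    using metrizable_loop_space[OF X] by (auto intro: metrizable_imp_k_space metrizable_imp_Hausdorff_space)
  have "continuous_map (prod_topology ?\<Omega> ?\<Omega>) (pi1_qtop X x0)
      (loop_class X x0 \<circ> (\<lambda>(\<alpha>, \<beta>). loop_concat \<alpha> \<beta>))"
    by (intro continuous_map_compose[OF continuous_map_loop_concat]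
        quotient_imp_continuous_map quotient_map_loop_class)
  from closedin_continuous_map_preimage[OF this C]
  have "closedin (prod_topology ?\<Omega> ?\<Omega>) {z \<in> topspace (prod_topology ?\<Omega> ?\<Omega>).
      (loop_class X x0 \<circ> (\<lambda>(\<alpha>, \<beta>). loop_concat \<alpha> \<beta>)) z \<in> C}" .
  moreover have "{z \<in> topspace (prod_topology ?\<Omega> ?\<Omega>).
      (loop_class X x0 \<circ> (\<lambda>(\<alpha>, \<beta>). loop_concat \<alpha> \<beta>)) z \<in> C} =
      {z \<in> topspace (prod_topology ?\<Omega> ?\<Omega>). (loop_class X x0 (fst z), loop_class X x0 (snd z)) \<in> ?S}"
    by (auto simp: mult_fundamental_group)
  ultimately show "closedin (prod_topology ?\<Omega> ?\<Omega>)
      {z \<in> topspace (prod_topology ?\<Omega> ?\<Omega>). (loop_class X x0 (fst z), loop_class X x0 (snd z)) \<in> ?S}"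
    by simp
qed blast

theorem theorem46:
  fixes X :: "'a topology" and x0 :: 'a
  assumes "path_connected_space X" and "metrizable_space X" and "x0 \<in> topspace X"
  shows "CG_group (fundamental_group X x0) (pi1_qtop X x0) \<and>
    (compactly_generated (prod_topology (pi1_qtop X x0) (pi1_qtop X x0)) \<longrightarrow>
      topological_group (fundamental_group X x0) (pi1_qtop X x0))"
proof -
  let ?G = "fundamental_group X x0" and ?T = "pi1_qtop X x0"
  have grp: "group ?G" using assms(3) by (rule group_fundamental_group)
  have inv: "continuous_map ?T ?T (\<lambda>x. inv\<^bsub>?G\<^esub> x)"
    using assms(3) by (rule continuous_map_inv_pi1_qtop)
  have mult_in: "(\<lambda>(x, y). x \<otimes>\<^bsub>?G\<^esub> y) \<in> topspace (prod_topology ?T ?T) \<rightarrow> topspace ?T"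
    using monoid.m_closed[OF group.is_monoid[OF grp]] by auto
  note mult_preimage = k_closed_mult_preimage[OF assms(2,3)]
  have metr: "metrizable_space (loop_space X x0)"
    using assms(2) by (rule metrizable_loop_space)
  have cg: "compactly_generated ?T"
    by (rule compactly_generated_quotient[OF quotient_map_loop_class
          metrizable_imp_k_space[OF metr] metrizable_imp_Hausdorff_space[OF metr]])
  \<comment> \<open>The closed sets of \<open>k_prod\<close> are the \<open>k_closed\<close> sets of
    the product, which is what \<open>mult_preimage\<close> delivers.\<close>
  have mult: "continuous_map (k_prod ?T ?T) ?T (\<lambda>(x, y). x \<otimes>\<^bsub>?G\<^esub> y)"
    unfolding continuous_map_closedin k_prod_def closedin_k_ification topspace_k_ification
    by (intro conjI allI impI mult_in mult_preimage)
  \<comment> \<open>Under compact generation the same \<open>k_closed\<close> preimages are closed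
    in the product topology itself.\<close>
  have "continuous_map (prod_topology ?T ?T) ?T (\<lambda>(x, y). x \<otimes>\<^bsub>?G\<^esub> y)"
    if "compactly_generated (prod_topology ?T ?T)"
    unfolding continuous_map_closedin
    by (intro conjI allI impI mult_in that[unfolded compactly_generated_def, rule_format] mult_preimage)
  then show ?thesis
    using grp inv cg mult
    unfolding CG_group_def topological_group_def carrier_fundamental_group topspace_pi1_qtop
    by (intro conjI impI refl)
qed

end
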